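(* Let $\psi:U_Z\to\mathbb{R}$ be an increasing convex functional such that $\lim_{z\to+\infty}\psi(n(Z-z)^+)=\psi(0)$ for every $n\in\mathbb{N}$. Then the following are equivalent: (i) $\psi(X)=\max_{\mu\in ca^+_Z}(\langle X,\mu\rangle-\psi^*_{C_Z}(\mu))$ for all $X\in U_Z$; (ii) $\psi(X_n)\downarrow\psi(X)$ for every $X\in U_Z$ and every sequence $(X_n)$ in $C_Z$ decreasing pointwise to $X$; (iii) $\psi(X)=\inf_{Y\in C_Z,\,Y\ge X}\psi(Y)$ for all $X\in U_Z$; (iv) $\psi^*_{C_Z}(\mu)=\psi^*_{U_Z}(\mu)$ for all $\mu\in ca^+_Z$.
   Context: Fix integers $J\ge0$, $T\ge1$. $\Omega$ is a non-empty subset of $((0,\infty)\times\mathbb{R}^J)^T$ with the Euclidean metric. $Z:\Omega\to[1,\infty)$ is continuous with $\{\omega\in\Omega:Z(\omega)\le z\}$ compact for every $z\in\mathbb{R}_+$. $U_Z$ (resp. $C_Z$) is the set of upper semicontinuous (resp. continuous) functions $X:\Omega\to\mathbb{R}$ with $X/Z$ bounded; note $(Z-z)^+\in C_Z\subseteq U_Z$. $ca^+_Z$ is the set of (nonnegative) Borel measures $\mu$ on $\Omega$ with $\int Z\,d\mu<\infty$; $\langle X,\mu\rangle=\int X\,d\mu$. $\psi$ increasing means $\psi(X)\ge\psi(Y)$ whenever $X\ge Y$. $\psi^*_{C_Z}(\mu)=\sup_{X\in C_Z}(\langle X,\mu\rangle-\psi(X))$ and $\psi^*_{U_Z}(\mu)=\sup_{X\in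 U_Z}(\langle X,\mu\rangle-\psi(X))$; $\downarrow$ denotes monotone decreasing convergence. *)

theory Defs
  imports "HOL-Analysis.Analysis"
begin

text \<open>Functions on \<Omega> are represented as total functions that vanish off \<Omega>
  (extensional representation), so that a functional on them depends only on
  their values on \<Omega>.\<close>

definition usc_on :: "'a::topological_space set \<Rightarrow> ('a \<Rightarrow> real) \<Rightarrow> bool" where
  "usc_on \<Omega> X \<longleftrightarrow> (\<forall>y::real. openin (top_of_set \<Omega>) {x\<in>\<Omega>. X x < y})"

definition Z_bounded :: "'a set \<Rightarrow> ('a \<Rightarrow> real) \<Rightarrow> ('a \<Rightarrow> real) \<Rightarrow> bool" where
  "Z_bounded \<Omega> Z X \<longleftrightarrow> (\<exists>c. \<forall>x\<in>\<Omega>. \<bar>X x / Z x\<bar> \<le> c)"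

definition U_Z :: "'a::topological_space set \<Rightarrow> ('a \<Rightarrow> real) \<Rightarrow> ('a \<Rightarrow> real) set" where
  "U_Z \<Omega> Z = {X. usc_on \<Omega> X \<and> Z_bounded \<Omega> Z X \<and> (\<forall>x. x \<notin> \<Omega> \<longrightarrow> X x = 0)}"

definition C_Z :: "'a::topological_space set \<Rightarrow> ('a \<Rightarrow> real) \<Rightarrow> ('a \<Rightarrow> real) set" where
  "C_Z \<Omega> Z = {X. continuous_on \<Omega> X \<and> Z_bounded \<Omega> Z X \<and> (\<forall>x. x \<notin> \<Omega> \<longrightarrow> X x = 0)}"

definition ca_Z :: "'a::topological_space set \<Rightarrow> ('a \<Rightarrow> real) \<Rightarrow> 'a measure set" where
  "ca_Z \<Omega> Z = {M. sets M = sets (restrict_space borel \<Omega>) \<and> (\<integral>\<^sup>+x. ennreal (Z x) \<partial>M) < \<infinity>}"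

definition pairing :: "('a \<Rightarrow> real) \<Rightarrow> 'a measure \<Rightarrow> real" where
  "pairing X M = (\<integral>x. X x \<partial>M)"

definition conj :: "('a \<Rightarrow> real) set \<Rightarrow> (('a \<Rightarrow> real) \<Rightarrow> real) \<Rightarrow> 'a measure \<Rightarrow> ereal" where
  "conj S \<psi> M = (SUP X\<in>S. ereal (pairing X M - \<psi> X))"

definition pospart_shift :: "'a set \<Rightarrow> ('a \<Rightarrow> real) \<Rightarrow> real \<Rightarrow> 'a \<Rightarrow> real" where
  "pospart_shift \<Omega> Z z = (\<lambda>x. if x \<in> \<Omega> then max (Z x - z) 0 else 0)"

definition increasing_on :: "('a \<Rightarrow> real) set \<Rightarrow> 'a set \<Rightarrow> (('a \<Rightarrow> real) \<Rightarrow> real) \<Rightarrow> bool" where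
  "increasing_on S \<Omega> \<psi> \<longleftrightarrow> (\<forall>X\<in>S. \<forall>Y\<in>S. (\<forall>x\<in>\<Omega>. Y x \<le> X x) \<longrightarrow> \<psi> Y \<le> \<psi> X)"

definition convex_functional_on :: "('a \<Rightarrow> real) set \<Rightarrow> (('a \<Rightarrow> real) \<Rightarrow> real) \<Rightarrow> bool" where
  "convex_functional_on S \<psi> \<longleftrightarrow> (\<forall>X\<in>S. \<forall>Y\<in>S. \<forall>a::real. 0 \<le> a \<and> a \<le> 1 \<longrightarrow>
      \<psi> (\<lambda>x. a * X x + (1 - a) * Y x) \<le> a * \<psi> X + (1 - a) * \<psi> Y)"

end

theory Submission
  imports Defs "HOL-Library.Function_Algebras"
begin

text \<open>For \<open>Z\<close>-bounded \<open>W\<close> let \<open>\<phi>(W)\<close> (\<open>upper W\<close> below) be the infimum of \<open>\<psi>(Y)\<close> over all \<open>Y \<ge> W\<close> in \<open>C\<^sub>Z\<close>;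
  it is convex and increasing, equals \<open>\<psi>\<close> on \<open>C\<^sub>Z\<close> and dominates \<open>\<psi>\<close> on \<open>U\<^sub>Z\<close>. Each of (i)-(iv) says
  that \<open>\<phi> = \<psi>\<close> on \<open>U\<^sub>Z\<close>. Dini's theorem on the compact sets \<open>{Z \<le> z}\<close> and the growth condition make
  \<open>\<phi>(X + W\<^sub>n)\<close> decrease to \<open>\<phi>(X)\<close> when continuous \<open>W\<^sub>n\<close> decrease to \<open>0\<close>, so a subgradient \<open>l\<close> of \<open>\<phi>\<close> at
  \<open>X \<in> U\<^sub>Z\<close> is a Daniell integral on \<open>C\<^sub>Z\<close>, given by a measure \<open>\<mu>\<close>. As \<open>X\<close> is a decreasing limit of elements
  of \<open>C\<^sub>Z\<close>, \<open>l(X) \<le> \<langle>X,\<mu>\<rangle>\<close>. Hence \<open>\<phi>(X) \<le> \<langle>X,\<mu>\<rangle> - \<psi>\<^sup>*(\<mu>)\<close> with the conjugate over \<open>C\<^sub>Z\<close>, the only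
  nontrivial inequality.\<close>

section \<open>Daniell functionals on bounded continuous functions\<close>

text \<open>\<open>U_Z\<close> is only a convex cone, while a Hahn-Banach argument needs a vector
  space; this is why \<open>upper\<close> is defined for every function bounded by a multiple of
  \<open>Z\<close>, semicontinuous or not. Since \<Omega> need not be compact, Dini's theorem
  controls \<open>W n\<close> only up to a multiple of (Z - z)^+, and that multiple grows as the
  desired accuracy improves; hence a growth condition for every n. A mere bound becomes a small
  increment by convexity: X + W lies on the segment from X to X + W/t. Positivity and continuity
  from above of the subgradient are inherited from \<open>upper\<close>. Daniell integration is set
  up for bounded functions, so the weight is moved in and out: \<open>L g\<close> is l at g Z, and
  the finite measure obtained receives the density 1/Z.\<close>

definition bounded_continuous :: "'a::topological_space set \<Rightarrow> ('a \<Rightarrow> real) set" where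
  "bounded_continuous \<Omega> = {f. continuous_on \<Omega> f \<and> bounded (f ` \<Omega>)}"

lemma bounded_continuous_iff:
  "f \<in> bounded_continuous \<Omega> \<longleftrightarrow> continuous_on \<Omega> f \<and> (\<exists>B. \<forall>x\<in>\<Omega>. \<bar>f x\<bar> \<le> B)"
  by (simp add: bounded_continuous_def bounded_iff)

lemma bounded_continuous_const [simp]: "(\<lambda>x. c) \<in> bounded_continuous \<Omega>"
  by (auto simp: bounded_continuous_iff)

lemma bounded_continuous_add:
  assumes "f \<in> bounded_continuous \<Omega>" "g \<in> bounded_continuous \<Omega>"
  shows "(\<lambda>x. f x + g x) \<in> bounded_continuous \<Omega>"
  using assms unfolding bounded_continuous_def
  by (auto intro: continuous_intros bounded_plus_comp)

lemma bounded_continuous_mult: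
  assumes "f \<in> bounded_continuous \<Omega>" "g \<in> bounded_continuous \<Omega>"
  shows "(\<lambda>x. f x * g x) \<in> bounded_continuous \<Omega>"
proof -
  obtain B C where "\<And>x. x \<in> \<Omega> \<Longrightarrow> \<bar>f x\<bar> \<le> B" "\<And>x. x \<in> \<Omega> \<Longrightarrow> \<bar>g x\<bar> \<le> C"
    using assms unfolding bounded_continuous_iff by blast
  then have "\<And>x. x \<in> \<Omega> \<Longrightarrow> \<bar>f x * g x\<bar> \<le> B * C"
    unfolding abs_mult by (meson abs_ge_zero mult_mono order_trans)
  moreover have "continuous_on \<Omega> f" "continuous_on \<Omega> g"
    using assms by (simp_all add: bounded_continuous_iff)
  ultimately show ?thesis
    unfolding bounded_continuous_iff by (blast intro: continuous_on_mult)
qed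

lemma bounded_continuous_diff:
  assumes "f \<in> bounded_continuous \<Omega>" "g \<in> bounded_continuous \<Omega>"
  shows "(\<lambda>x. f x - g x) \<in> bounded_continuous \<Omega>"
  using assms unfolding bounded_continuous_def
  by (auto intro: continuous_intros bounded_minus_comp)

lemma bounded_continuous_max:
  assumes "f \<in> bounded_continuous \<Omega>" "g \<in> bounded_continuous \<Omega>"
  shows "(\<lambda>x. max (f x) (g x)) \<in> bounded_continuous \<Omega>"
proof -
  obtain B C where "\<And>x. x \<in> \<Omega> \<Longrightarrow> \<bar>f x\<bar> \<le> B" "\<And>x. x \<in> \<Omega> \<Longrightarrow> \<bar>g x\<bar> \<le> C"
    using assms unfolding bounded_continuous_iff by blast
  then have "\<And>x. x \<in> \<Omega> \<Longrightarrow> \<bar>max (f x) (g x)\<bar> \<le> max B C"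
    by (simp add: max_def) (smt (verit, best))
  moreover have "continuous_on \<Omega> f" "continuous_on \<Omega> g"
    using assms by (simp_all add: bounded_continuous_iff)
  ultimately show ?thesis
    unfolding bounded_continuous_iff by (blast intro: continuous_on_max)
qed

lemma bounded_continuous_min_const:
  assumes "f \<in> bounded_continuous \<Omega>"
  shows "(\<lambda>x. min (f x) c) \<in> bounded_continuous \<Omega>"
proof -
  have "(\<lambda>x. 0 - max (0 - f x) (- c)) \<in> bounded_continuous \<Omega>"
    by (intro bounded_continuous_diff bounded_continuous_max bounded_continuous_const assms)
  moreover have "(\<lambda>x. 0 - max (0 - f x) (- c)) = (\<lambda>x. min (f x) c)"
    by (auto simp: fun_eq_iff)
  ultimately show ?thesis by simp
qed

lemma bounded_continuous_sum:
  "(\<And>i. i \<in> I \<Longrightarrow> f i \<in> bounded_continuous \<Omega>) \<Longrightarrow> (\<lambda>x. \<Sum>i\<in>I. f i x) \<in> bounded_continuous \<Omega>"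
  by (induction I rule: infinite_finite_induct)
     (auto intro: bounded_continuous_const bounded_continuous_add)

lemmas bounded_continuous_intros =
  bounded_continuous_const bounded_continuous_add bounded_continuous_mult bounded_continuous_diff
  bounded_continuous_max bounded_continuous_min_const bounded_continuous_sum

section \<open>Caratheodory's construction for a Daniell functional\<close>

locale Daniell_functional =
  fixes \<Omega> :: "'a::metric_space set" and L :: "('a \<Rightarrow> real) \<Rightarrow> real"
  assumes L_add: "\<And>f g. f \<in> bounded_continuous \<Omega> \<Longrightarrow> g \<in> bounded_continuous \<Omega> \<Longrightarrow>
      L (\<lambda>x. f x + g x) = L f + L g"
    and L_scale: "\<And>c f. f \<in> bounded_continuous \<Omega> \<Longrightarrow> L (\<lambda>x. c * f x) = c * L f"
    and L_mono: "\<And>f g. f \<in> bounded_continuous \<Omega> \<Longrightarrow> g \<in> bounded_continuous \<Omega> \<Longrightarrow>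
      (\<And>x. x \<in> \<Omega> \<Longrightarrow> f x \<le> g x) \<Longrightarrow> L f \<le> L g"
    and L_cont: "\<And>f. (\<And>n::nat. f n \<in> bounded_continuous \<Omega>) \<Longrightarrow>
      (\<And>x. x \<in> \<Omega> \<Longrightarrow> decseq (\<lambda>n. f n x)) \<Longrightarrow> (\<And>x. x \<in> \<Omega> \<Longrightarrow> (\<lambda>n. f n x) \<longlonglongrightarrow> 0) \<Longrightarrow>
      (\<lambda>n. L (f n)) \<longlonglongrightarrow> 0"
begin

lemma L_zero: "L (\<lambda>x. 0) = 0"
  using L_scale[of "\<lambda>x. 0" 0] by simp

lemma L_nonneg: "f \<in> bounded_continuous \<Omega> \<Longrightarrow> (\<And>x. x \<in> \<Omega> \<Longrightarrow> 0 \<le> f x) \<Longrightarrow> 0 \<le> L f"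
  using L_mono[of "\<lambda>x. 0" f] by (simp add: L_zero)

lemma L_sum: "(\<And>i. i \<in> I \<Longrightarrow> f i \<in> bounded_continuous \<Omega>) \<Longrightarrow>
    L (\<lambda>x. \<Sum>i\<in>I. f i x) = (\<Sum>i\<in>I. L (f i))"
  by (induction I rule: infinite_finite_induct)
     (auto simp: L_zero intro!: L_add[THEN trans] bounded_continuous_sum)

definition covers :: "'a set \<Rightarrow> (nat \<Rightarrow> 'a \<Rightarrow> real) set" where
  "covers A = {f. (\<forall>n. f n \<in> bounded_continuous \<Omega> \<and> (\<forall>x\<in>\<Omega>. 0 \<le> f n x)) \<and>
                  (\<forall>x\<in>A. 1 \<le> (\<Sum>n. ennreal (f n x)))}"

text \<open>This is Daniell's upper integral of the indicator of \<open>A\<close>, with countable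
  sums of nonnegative functions in place of increasing limits.\<close>

definition outer :: "'a set \<Rightarrow> ennreal" where
  "outer A = (INF f\<in>covers A. \<Sum>n. ennreal (L (f n)))"

text \<open>Double families arise twice: by concatenating covers for countable subadditivity, and by
  slicing a cover along an open set. Enumerating the pairs makes a single cover of them.\<close>

lemma outer_le_double_suminf:
  assumes f: "\<And>j n::nat. f j n \<in> bounded_continuous \<Omega>" "\<And>j n x. x \<in> \<Omega> \<Longrightarrow> 0 \<le> f j n x"
    and A: "\<And>x. x \<in> A \<Longrightarrow> 1 \<le> (\<Sum>j. \<Sum>n. ennreal (f j n x))"
  shows "outer A \<le> (\<Sum>j. \<Sum>n. ennreal (L (f j n)))"
proof -
  let ?g = "\<lambda>k. case_prod f (prod_decode k)"
  have "(\<Sum>k. ennreal (?g k x)) = (\<Sum>j. \<Sum>n. ennreal (f j n x))" for x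
    using suminf_ennreal_2dimen[of "\<lambda>j. \<Sum>n. ennreal (f j n x)" "\<lambda>p. ennreal (case_prod f p x)"]
    by simp
  then have "?g \<in> covers A"
    using f A by (auto simp: covers_def split: prod.split)
  moreover have "(\<Sum>k. ennreal (L (?g k))) = (\<Sum>j. \<Sum>n. ennreal (L (f j n)))"
    using suminf_ennreal_2dimen[of "\<lambda>j. \<Sum>n. ennreal (L (f j n))" "\<lambda>p. ennreal (L (case_prod f p))"]
    by simp
  moreover have "g \<in> covers A \<Longrightarrow> outer A \<le> (\<Sum>k. ennreal (L (g k)))" for g
    unfolding outer_def by (rule INF_lower)
  ultimately show ?thesis
    by metis
qed

lemma outer_le:
  assumes "f \<in> bounded_continuous \<Omega>" "\<And>x. x \<in> \<Omega> \<Longrightarrow> 0 \<le> f x" "\<And>x. x \<in> A \<Longrightarrow> 1 \<le> f x"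
    and "A \<subseteq> \<Omega>"
  shows "outer A \<le> ennreal (L f)"
proof -
  let ?g = "\<lambda>n x. if n = (0::nat) then f x else 0"
  have s: "(\<Sum>n. ennreal (if n = (0::nat) then c else 0)) = ennreal c" for c
    using suminf_finite[of "{0::nat}" "\<lambda>n. ennreal (if n = (0::nat) then c else 0)"] by simp
  have L': "L (?g n) = (if n = 0 then L f else 0)" for n
    by (cases "n = 0") (auto simp: L_zero)
  have "?g n \<in> bounded_continuous \<Omega>" for n
    using assms(1) by (cases "n = 0") auto
  then have "?g \<in> covers A"
    using assms s unfolding covers_def by (auto simp: subset_iff simp flip: ennreal_1 intro!: ennreal_leI)
  then have "outer A \<le> (\<Sum>n. ennreal (L (?g n)))"
    unfolding outer_def by (rule INF_lower)
  then show ?thesis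
    unfolding L' s .
qed

lemma outer_mono: "A \<subseteq> B \<Longrightarrow> outer A \<le> outer B"
  unfolding outer_def by (rule INF_superset_mono) (auto simp: covers_def)

lemma outer_measure_space_outer: "outer_measure_space (Pow \<Omega>) outer"
  unfolding outer_measure_space_def
proof (intro conjI)
  have "outer {} \<le> ennreal (L (\<lambda>x. 0))"
    by (rule outer_le) (auto intro: bounded_continuous_const)
  then show "positive (Pow \<Omega>) outer"
    by (simp add: positive_def L_zero)
  show "increasing (Pow \<Omega>) outer"
    by (auto simp: increasing_def intro: outer_mono)
  show "countably_subadditive (Pow \<Omega>) outer"
    unfolding countably_subadditive_def
  proof safe
    fix A :: "nat \<Rightarrow> _"
    show "outer (\<Union>i. A i) \<le> (\<Sum>n. outer (A n))"
    proof (rule ennreal_le_epsilon)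
      fix e :: real assume e: "0 < e" and fin: "(\<Sum>n. outer (A n)) < top"
      have "\<exists>f\<in>covers (A n). (\<Sum>i. ennreal (L (f i))) < outer (A n) + e * (1/2)^Suc n" for n
      proof -
        \<comment> \<open>The increase is strict because the sum of all \<open>outer (A n)\<close>
          is finite here, hence so is each term.\<close>
        have "outer (A n) < outer (A n) + e * (1/2)^Suc n"
          using e fin by (auto simp add: less_top dest!: ennreal_suminf_lessD)
        then show ?thesis
          unfolding outer_def by (subst (asm) INF_less_iff)
      qed
      then obtain f where f: "\<And>n. f n \<in> covers (A n)"
        and le: "\<And>n. (\<Sum>i. ennreal (L (f n i))) < outer (A n) + e * (1/2)^Suc n"
        by metis
      have "outer (\<Union>i. A i) \<le> (\<Sum>n. \<Sum>i. ennreal (L (f n i)))"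
      proof (rule outer_le_double_suminf)
        fix x assume "x \<in> (\<Union>i. A i)"
        then obtain n where "x \<in> A n" by blast
        then have "1 \<le> (\<Sum>i. ennreal (f n i x))"
          using f[of n] by (simp add: covers_def)
        also have "\<dots> \<le> (\<Sum>n. \<Sum>i. ennreal (f n i x))"
          using sum_le_suminf[of "\<lambda>n. \<Sum>i. ennreal (f n i x)" "{n}"] by simp
        finally show "1 \<le> (\<Sum>n. \<Sum>i. ennreal (f n i x))" .
      qed (use f in \<open>auto simp: covers_def\<close>)
      also have "\<dots> \<le> (\<Sum>n. outer (A n) + e * (1/2) ^ Suc n)"
        using le by (intro suminf_le) (auto intro: less_imp_le)
      also have "... = (\<Sum>n. outer (A n)) + (\<Sum>n. ennreal e * ennreal ((1/2) ^ Suc n))"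
        using \<open>0 < e\<close> by (subst suminf_add[symmetric])
                         (auto simp del: ennreal_suminf_cmult simp add: ennreal_mult[symmetric])
      also have "\<dots> = (\<Sum>n. outer (A n)) + e"
        unfolding ennreal_suminf_cmult
        by (subst suminf_ennreal_eq[OF zero_le_power power_half_series]) auto
      finally show "outer (\<Union>i. A i) \<le> (\<Sum>n. outer (A n)) + e" .
    qed
  qed
qed

text \<open>With continuous \<open>k\<^sub>m \<up> 1\<^sub>U\<close>, the pieces \<open>f (k\<^sub>m\<^sub>+\<^sub>1 - k\<^sub>m)\<close> of a cover \<open>f\<close> of \<open>E\<close> cover
  \<open>E \<inter> U\<close>, while each \<open>f (1 - k\<^sub>m)\<close> covers \<open>E - U\<close>.\<close>
lemma open_in_lambda_system:
  assumes "open U"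
  shows "\<Omega> \<inter> U \<in> lambda_system \<Omega> (Pow \<Omega>) outer"
proof (cases "U = UNIV")
  \<comment> \<open>The complement is empty and \<open>infdist\<close> to the empty set is 0 by
    convention, so the functions \<open>k\<close> of the other case would vanish
    identically.\<close>
  case True
  have "outer {} = 0"
    using outer_measure_space_outer by (auto simp: outer_measure_space_def positive_def)
  then show ?thesis
    using True by (auto simp: lambda_system_def Int_absorb1)
next
  case False
  define k where "k m x = min (real m * infdist x (- U)) 1" for m x
  have k_bc: "k m \<in> bounded_continuous \<Omega>" for m
    unfolding bounded_continuous_iff k_def
    by (intro conjI continuous_intros exI[of _ 1]) (auto simp: infdist_nonneg)
  have k0: "k 0 x = 0" for x by (simp add: k_def)
  have k_le1: "k m x \<le> 1" for m x by (simp add: k_def)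
  have k_mono: "k m x \<le> k (Suc m) x" for m x
    unfolding k_def by (intro min.mono mult_right_mono) (auto simp: infdist_nonneg)
  have k_out: "k m x = 0" if "x \<notin> U" for m x
    using that by (simp add: k_def)
  have k_lim: "(\<lambda>m. k m x) \<longlonglongrightarrow> 1" if "x \<in> U" for x
  proof (rule tendsto_eventually)
    have "x \<notin> closure (- U)" using that assms by (simp add: closure_complement interior_open)
    then have "infdist x (- U) > 0"
      using False in_closure_iff_infdist_zero[of "- U" x] infdist_nonneg[of x "- U"] by force
    then obtain m0 :: nat where "real m0 * infdist x (- U) > 1"
      using reals_Archimedean3 by blast
    then have "k m x = 1" if "m \<ge> m0" for m
      using that infdist_nonneg[of x "- U"] unfolding k_def
      by (smt (verit, best) mult_right_mono of_nat_le_iff)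
    then show "\<forall>\<^sub>F m in sequentially. k m x = 1"
      by (auto simp: eventually_sequentially)
  qed
  have "outer (E \<inter> U) + outer (E - U) \<le> outer E" if E: "E \<subseteq> \<Omega>" for E
    unfolding outer_def[of E]
  proof (rule INF_greatest)
    fix f assume "f \<in> covers E"
    then have f: "\<And>n. f n \<in> bounded_continuous \<Omega>" "\<And>n x. x \<in> \<Omega> \<Longrightarrow> 0 \<le> f n x"
      and fE: "\<And>x. x \<in> E \<Longrightarrow> 1 \<le> (\<Sum>n. ennreal (f n x))"
      by (auto simp: covers_def)
    define g where "g j n x = f n x * (k (Suc j) x - k j x)" for j n x
    have g: "g j n \<in> bounded_continuous \<Omega>" for j n
      unfolding g_def by (intro bounded_continuous_intros f k_bc)
    have g_nonneg: "0 \<le> g j n x" if "x \<in> \<Omega>" for j n x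
      using f(2)[OF that] k_mono[of j x] by (simp add: g_def)
    have "outer (E \<inter> U) \<le> (\<Sum>j. \<Sum>n. ennreal (L (g j n)))"
    proof (rule outer_le_double_suminf[OF g g_nonneg])
      fix x assume x: "x \<in> E \<inter> U"
      have "(\<lambda>j. k (Suc j) x - k j x) sums (1 - k 0 x)"
        using x by (intro telescope_sums k_lim) auto
      then have "(\<Sum>j. ennreal (k (Suc j) x - k j x)) = ennreal (1 - k 0 x)"
        by (intro suminf_ennreal_eq) (simp_all only: k_mono diff_ge_0_iff_ge)
      then have "(\<Sum>j. ennreal (k (Suc j) x - k j x)) = 1"
        by (simp only: k0 diff_zero ennreal_1)
      then have "(\<Sum>j. (\<Sum>n. ennreal (f n x)) * ennreal (k (Suc j) x - k j x)) = (\<Sum>n. ennreal (f n x))"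
        by (simp only: ennreal_suminf_cmult mult_1_right)
      moreover have "(\<Sum>n. ennreal (f n x)) * ennreal (k (Suc j) x - k j x) = (\<Sum>n. ennreal (g j n x))" for j
        using x E f(2) k_mono[of j x]
        by (subst ennreal_suminf_multc[symmetric]) (auto simp: g_def ennreal_mult'')
      ultimately show "1 \<le> (\<Sum>j. \<Sum>n. ennreal (g j n x))"
        using fE x by auto
    qed auto
    \<comment> \<open>It suffices to treat finitely many slices: for fixed \<open>m\<close>, the
      slices below \<open>m\<close> and the remainder \<open>?r n\<close> add up to
      \<open>f n\<close> exactly, so additivity of \<open>L\<close> loses nothing.\<close>
    also have "\<dots> = (SUP m. \<Sum>j<m. \<Sum>n. ennreal (L (g j n)))"
      by (rule suminf_eq_SUP)
    finally have "outer (E \<inter> U) + outer (E - U) \<le>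
        (SUP m. (\<Sum>j<m. \<Sum>n. ennreal (L (g j n))) + outer (E - U))"
      by (subst ennreal_SUP_add_left) (auto intro: add_right_mono)
    also have "\<dots> \<le> (\<Sum>n. ennreal (L (f n)))"
    proof (rule SUP_least)
      fix m
      let ?r = "\<lambda>n x. f n x * (1 - k m x)"
      have r: "?r n \<in> bounded_continuous \<Omega>" for n
        by (intro bounded_continuous_intros f k_bc)
      have r_nonneg: "0 \<le> ?r n x" if "x \<in> \<Omega>" for n x
        using f(2)[OF that] k_le1[of m x] by simp
      have "?r \<in> covers (E - U)"
        unfolding covers_def using r r_nonneg fE k_out by auto
      then have "outer (E - U) \<le> (\<Sum>n. ennreal (L (?r n)))"
        unfolding outer_def by (rule INF_lower)
      moreover have "(\<Sum>j<m. \<Sum>n. ennreal (L (g j n))) = (\<Sum>n. \<Sum>j<m. ennreal (L (g j n)))"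
        by (rule suminf_sum[symmetric]) simp
      moreover have split: "(\<Sum>j<m. ennreal (L (g j n))) + ennreal (L (?r n)) = ennreal (L (f n))" for n
      proof -
        have "(\<Sum>j<m. L (g j n)) + L (?r n) = L (\<lambda>x. (\<Sum>j<m. g j n x) + ?r n x)"
          using g r by (simp add: L_add L_sum bounded_continuous_sum)
        also have "(\<lambda>x. (\<Sum>j<m. g j n x) + ?r n x) = f n"
        proof
          fix x
          have "(\<Sum>j<m. g j n x) = f n x * (k m x - k 0 x)"
            unfolding g_def sum_distrib_left[symmetric] by (subst sum_lessThan_telescope) simp
          then show "(\<Sum>j<m. g j n x) + ?r n x = f n x"
            by (simp add: k0 algebra_simps)
        qed
        finally have "(\<Sum>j<m. L (g j n)) + L (?r n) = L (f n)" .
        moreover have "0 \<le> L (g j n)" for j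
          using g g_nonneg by (intro L_nonneg) auto
        moreover have "0 \<le> L (?r n)"
          using r r_nonneg by (intro L_nonneg) auto
        ultimately show ?thesis
          by (simp add: sum_nonneg flip: ennreal_plus)
      qed
      ultimately have "(\<Sum>j<m. \<Sum>n. ennreal (L (g j n))) + outer (E - U) \<le>
          (\<Sum>n. \<Sum>j<m. ennreal (L (g j n))) + (\<Sum>n. ennreal (L (?r n)))"
        by (simp add: add_left_mono)
      also have "\<dots> = (\<Sum>n. (\<Sum>j<m. ennreal (L (g j n))) + ennreal (L (?r n)))"
        by (rule suminf_add) auto
      also have "\<dots> = (\<Sum>n. ennreal (L (f n)))"
        by (simp only: split)
      finally show "(\<Sum>j<m. \<Sum>n. ennreal (L (g j n))) + outer (E - U) \<le> (\<Sum>n. ennreal (L (f n)))" .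
    qed
    finally show "outer (E \<inter> U) + outer (E - U) \<le> (\<Sum>n. ennreal (L (f n)))" .
  qed
  moreover have "outer E \<le> outer (E \<inter> U) + outer (E - U)" if "E \<subseteq> \<Omega>" for E
  proof -
    have "subadditive (Pow \<Omega>) outer"
      using outer_measure_space_outer ring_of_sets.countably_subadditive_subadditive[OF ring_of_sets_Pow]
      by (auto simp: outer_measure_space_def)
    from subadditiveD[OF this, of "E \<inter> U" "E - U"] that show ?thesis
      by (simp add: Int_Diff_Un Int_Diff_disjoint Diff_subset_conv le_supI2 subset_iff)
  qed
  moreover have "E \<inter> (\<Omega> \<inter> U) = E \<inter> U" "E - \<Omega> \<inter> U = E - U" if "E \<subseteq> \<Omega>" for E
    using that by auto
  ultimately show ?thesis
    by (auto simp: algebra.lambda_system_eq[OF algebra_Pow] intro: antisym)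
qed

text \<open>Continuity of \<open>L\<close> enters the construction only here, where it rules out a
  loss of mass. The deficit (1 - partial sum)^+ of a cover is bounded, continuous and decreases to
  0, so its \<open>L\<close>-value vanishes in the limit and the partial sums account for all of L
  1.\<close>

lemma outer_space: "outer \<Omega> = ennreal (L (\<lambda>x. 1))"
proof (rule antisym)
  show "outer \<Omega> \<le> ennreal (L (\<lambda>x. 1))"
    by (rule outer_le) (auto intro: bounded_continuous_const)
  show "ennreal (L (\<lambda>x. 1)) \<le> outer \<Omega>"
    unfolding outer_def
  proof (rule INF_greatest)
    fix f assume "f \<in> covers \<Omega>"
    then have f: "\<And>n. f n \<in> bounded_continuous \<Omega>" "\<And>n x. x \<in> \<Omega> \<Longrightarrow> 0 \<le> f n x"
      and f1: "\<And>x. x \<in> \<Omega> \<Longrightarrow> 1 \<le> (\<Sum>n. ennreal (f n x))"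
      by (auto simp: covers_def)
    define g where "g N x = max 0 (1 - (\<Sum>n<N. f n x))" for N x
    have g: "g N \<in> bounded_continuous \<Omega>" for N
      unfolding g_def by (intro bounded_continuous_intros f)
    have dec: "decseq (\<lambda>N. g N x)" if "x \<in> \<Omega>" for x
      using f(2)[OF that] by (intro decseq_SucI) (auto simp: g_def intro!: max.coboundedI2)
    have lim: "(\<lambda>N. g N x) \<longlonglongrightarrow> 0" if "x \<in> \<Omega>" for x
    proof (rule decreasing_tendsto)
      show "\<forall>\<^sub>F N in sequentially. 0 \<le> g N x" by (simp add: g_def)
      fix e :: real assume e: "0 < e"
      have "ennreal (1 - e) < 1"
        using e by simp
      also have "1 \<le> (SUP N. \<Sum>n<N. ennreal (f n x))"
        using f1[OF that] by (simp add: suminf_eq_SUP)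
      finally obtain N where "ennreal (1 - e) < (\<Sum>n<N. ennreal (f n x))"
        unfolding less_SUP_iff by blast
      then have "ennreal (1 - e) < ennreal (\<Sum>n<N. f n x)"
        by (simp add: f(2)[OF that])
      then have "1 - e < (\<Sum>n<N. f n x)"
        by (meson ennreal_leI leD leI)
      then have "g N x < e" using e by (simp add: g_def)
      with dec[OF that] show "\<forall>\<^sub>F N in sequentially. g N x < e"
        by (auto simp: eventually_sequentially decseq_def intro: order_le_less_trans)
    qed
    have "(\<lambda>N. L (g N)) \<longlonglongrightarrow> 0"
      by (rule L_cont[OF g dec lim])
    then have "(\<lambda>N. (\<Sum>n. ennreal (L (f n))) + ennreal (L (g N))) \<longlonglongrightarrow> (\<Sum>n. ennreal (L (f n))) + ennreal 0"
      by (intro tendsto_intros tendsto_ennrealI)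
    moreover have "ennreal (L (\<lambda>x. 1)) \<le> (\<Sum>n. ennreal (L (f n))) + ennreal (L (g N))" for N
    proof -
      have "L (\<lambda>x. 1) \<le> L (\<lambda>x. (\<Sum>n<N. f n x) + g N x)"
        by (intro L_mono bounded_continuous_intros f g) (simp add: g_def)
      also have "\<dots> = (\<Sum>n<N. L (f n)) + L (g N)"
        using f g by (simp add: L_add L_sum bounded_continuous_sum)
      finally have "ennreal (L (\<lambda>x. 1)) \<le> ennreal ((\<Sum>n<N. L (f n)) + L (g N))"
        by (rule ennreal_leI)
      also have "\<dots> = (\<Sum>n<N. ennreal (L (f n))) + ennreal (L (g N))"
      proof -
        have "0 \<le> L (g N)" by (rule L_nonneg[OF g]) (simp add: g_def)
        moreover have "0 \<le> L (f n)" for n using f by (intro L_nonneg) auto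
        ultimately show ?thesis by (simp add: sum_nonneg)
      qed
      also have "\<dots> \<le> (\<Sum>n. ennreal (L (f n))) + ennreal (L (g N))"
        by (intro add_right_mono sum_le_suminf) auto
      finally show ?thesis .
    qed
    ultimately show "ennreal (L (\<lambda>x. 1)) \<le> (\<Sum>n. ennreal (L (f n)))"
      by (intro LIMSEQ_le_const) auto
  qed
qed

text \<open>Bounding the integral by \<open>L\<close> needs only upper estimates for the measures of
  superlevel sets, which covers supply. Equality follows by replacing f with -f; signed functions
  are reached by adding constants, for which the total mass must be exactly L 1.\<close>

theorem representation:
  obtains M where "sets M = sets (restrict_space borel \<Omega>)" "finite_measure M"
    "\<And>f. f \<in> bounded_continuous \<Omega> \<Longrightarrow> integrable M f"
    "\<And>f. f \<in> bounded_continuous \<Omega> \<Longrightarrow> (\<integral>x. f x \<partial>M) = L f"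
proof -
  let ?S = "sets (restrict_space borel \<Omega>)"
  define M where "M = measure_of \<Omega> ?S outer"
  have S: "sigma_algebra \<Omega> ?S"
    using sets.sigma_algebra_axioms[of "restrict_space borel \<Omega>"] by (simp add: space_restrict_space)
  have oms: "measure_space \<Omega> (lambda_system \<Omega> (Pow \<Omega>) outer) outer"
    by (rule sigma_algebra.caratheodory_lemma[OF sigma_algebra_Pow outer_measure_space_outer])
  have "?S \<subseteq> lambda_system \<Omega> (Pow \<Omega>) outer"
  proof -
    interpret sigma_algebra \<Omega> "lambda_system \<Omega> (Pow \<Omega>) outer"
      using oms by (simp add: measure_space_def)
    have "?S = {(\<lambda>x. x) -` A \<inter> \<Omega> |A. A \<in> sigma_sets UNIV {U. open U}}"
      by (auto simp: sets_restrict_space borel_def)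
    also have "\<dots> = sigma_sets \<Omega> {(\<lambda>x. x) -` A \<inter> \<Omega> |A. A \<in> {U. open U}}"
      by (rule sigma_sets_vimage_commute) simp
    also have "\<dots> \<subseteq> lambda_system \<Omega> (Pow \<Omega>) outer"
      using open_in_lambda_system by (intro sigma_sets_subset) (auto simp: Int_commute)
    finally show ?thesis .
  qed
  then have "positive ?S outer" "countably_additive ?S outer"
    using oms by (auto simp: measure_space_def positive_def countably_additive_def)
  then have emeasure_M: "emeasure M A = outer A" if "A \<in> ?S" for A
    using S that unfolding M_def by (intro emeasure_measure_of_sigma)
  have sets_M: "sets M = ?S" and space_M: "space M = \<Omega>"
    using S unfolding M_def by (auto simp: sigma_algebra.sets_measure_of_eq sigma_algebra.space_measure_of_eq)
  have emeasure_space: "emeasure M (space M) = ennreal (L (\<lambda>x. 1))"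
    using emeasure_M[of \<Omega>] sets.top[of M] by (simp add: sets_M space_M outer_space)
  interpret finite_measure M
    by standard (simp add: emeasure_space)
  have L1: "0 \<le> L (\<lambda>x. 1)"
    by (intro L_nonneg bounded_continuous_const) simp
  have total: "measure M (space M) = L (\<lambda>x. 1)"
    using emeasure_space L1 by (simp add: measure_def)
  have meas: "f \<in> borel_measurable M" if "f \<in> bounded_continuous \<Omega>" for f
  proof -
    have "f \<in> borel_measurable (restrict_space borel \<Omega>)"
      using that by (intro borel_measurable_continuous_on_restrict) (simp add: bounded_continuous_def)
    then show ?thesis
      by (simp add: measurable_cong_sets[OF sets_M refl])
  qed
  have int: "integrable M f" if f: "f \<in> bounded_continuous \<Omega>" for f
  proof -
    obtain B where "\<And>x. x \<in> \<Omega> \<Longrightarrow> \<bar>f x\<bar> \<le> B"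
      using f by (auto simp: bounded_continuous_iff)
    then show ?thesis
      by (intro integrable_const_bound[of _ B] meas f) (auto simp: space_M)
  qed
  have le_nonneg: "(\<integral>x. f x \<partial>M) \<le> L f"
    if f: "f \<in> bounded_continuous \<Omega>" and f0: "\<And>x. x \<in> \<Omega> \<Longrightarrow> 0 \<le> f x" for f
  proof (rule field_le_epsilon)
    fix e :: real assume "0 < e"
    \<comment> \<open>Height of the horizontal slices of \<open>f\<close>. The estimate loses one
      slice, of integral at most \<open>d\<close> times L 1, and this choice keeps that below
      \<open>e\<close> even if L 1 = 0.\<close>
    define d where "d = e / (L (\<lambda>x. 1) + 1)"
    have d: "0 < d" "d * L (\<lambda>x. 1) \<le> e"
      using \<open>0 < e\<close> L1 by (auto simp: d_def field_simps)
    obtain B where B: "\<And>x. x \<in> \<Omega> \<Longrightarrow> \<bar>f x\<bar> \<le> B"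
      using f by (auto simp: bounded_continuous_iff)
    obtain N :: nat where "B < N * d"
      using reals_Archimedean3[OF d(1)] by blast
    then have N: "f x \<le> real N * d" if "x \<in> \<Omega>" for x
      using B[OF that] by linarith
    \<comment> \<open>Slice \<open>j\<close> of \<open>f\<close> is full, of height
      \<open>d\<close>, where \<open>f\<close> reaches (j + 1) d. Hence h j / d is a cover of
      \<open>A j\<close> by one function, which yields \<open>A_le\<close>.\<close>
    define h where "h j x = min (f x) (real (Suc j) * d) - min (f x) (real j * d)" for j x
    have h: "h j \<in> bounded_continuous \<Omega>" for j
      unfolding h_def by (intro bounded_continuous_intros f)
    have jd: "real j * d \<le> real (Suc j) * d" for j
      using d by (intro mult_right_mono) auto
    have h0: "0 \<le> h j x" for j x
      using jd[of j] by (simp add: h_def min_def)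
    have sum_h: "(\<Sum>j<N. h j x) = min (f x) (real N * d)" if "x \<in> \<Omega>" for N x
      unfolding h_def by (subst sum_lessThan_telescope) (use f0[OF that] in simp)
    define A where "A j = {x \<in> \<Omega>. real (Suc j) * d \<le> f x}" for j
    have A: "A j \<in> sets M" for j
    proof -
      have "{x \<in> space M. real (Suc j) * d \<le> f x} \<in> sets M"
        using meas[OF f] by measurable
      then show ?thesis by (simp add: A_def space_M)
    qed
    have A_le: "d * measure M (A j) \<le> L (h j)" for j
    proof -
      have "outer (A j) \<le> ennreal (L (\<lambda>x. (1 / d) * h j x))"
      proof (rule outer_le)
        show "(\<lambda>x. (1 / d) * h j x) \<in> bounded_continuous \<Omega>"
          by (intro bounded_continuous_intros h)
        fix x assume "x \<in> A j"
        then have "h j x = d"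
          using jd[of j] by (auto simp: A_def h_def min_def algebra_simps)
        then show "1 \<le> (1 / d) * h j x" using d by simp
      qed (use h0 d in \<open>auto simp: A_def\<close>)
      also have "L (\<lambda>x. (1 / d) * h j x) = L (h j) / d"
        using L_scale[OF h, of "1 / d" j] by simp
      finally have "ennreal (measure M (A j)) \<le> ennreal (L (h j) / d)"
        using A emeasure_M[of "A j"] by (simp add: emeasure_eq_measure sets_M)
      moreover have "0 \<le> L (h j) / d"
        using d h h0 by (intro divide_nonneg_pos L_nonneg) auto
      ultimately show ?thesis
        using d by (simp add: ennreal_le_iff field_simps)
    qed
    have "f x \<le> d + (\<Sum>j<N. d * indicator (A j) x)" if x: "x \<in> \<Omega>" for x
    proof -
      \<comment> \<open>The index shift gives an upper bound: slice j + 1 is nonzero only where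
        slice j is already full. The unmatched slice 0 contributes at most \<open>d\<close>.\<close>
      have hA: "h (Suc j) x \<le> d * indicator (A j) x" for j
        using x d by (cases "x \<in> A j") (auto simp: A_def h_def min_def algebra_simps)
      have "f x = (\<Sum>j<Suc N. h j x)"
        using sum_h[OF x, of "Suc N"] N[OF x] jd[of N] by (simp only: min_absorb1)
      also have "\<dots> = h 0 x + (\<Sum>j<N. h (Suc j) x)"
        by (rule sum.lessThan_Suc_shift)
      also have "h 0 x \<le> d"
        using f0[OF x] by (simp add: h_def)
      also have "(\<Sum>j<N. h (Suc j) x) \<le> (\<Sum>j<N. d * indicator (A j) x)"
        by (intro sum_mono hA)
      finally show ?thesis by simp
    qed
    then have "(\<integral>x. f x \<partial>M) \<le> (\<integral>x. d + (\<Sum>j<N. d * indicator (A j) x) \<partial>M)"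
      using A int[OF f]
      by (intro integral_mono Bochner_Integration.integrable_add Bochner_Integration.integrable_sum
        integrable_mult_right integrable_real_indicator) (auto simp: space_M less_top[symmetric])
    also have "\<dots> = (\<integral>x. d \<partial>M) + (\<Sum>j<N. \<integral>x. d * indicator (A j) x \<partial>M)"
    proof -
      have "integrable M (\<lambda>x. d * indicator (A j) x)" for j
        using A by (intro integrable_mult_right integrable_real_indicator) (auto simp: less_top[symmetric])
      then show ?thesis
        by (subst Bochner_Integration.integral_add)
           (auto intro: Bochner_Integration.integral_sum Bochner_Integration.integrable_sum simp del: sum_mult_indicator)
    qed
    also have "\<dots> = d * L (\<lambda>x. 1) + (\<Sum>j<N. d * measure M (A j))"
      using sets.sets_into_space[OF A] by (simp add: total Int_absorb2)
    also have "\<dots> \<le> e + (\<Sum>j<N. L (h j))"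
      by (intro add_mono sum_mono A_le d)
    also have "(\<Sum>j<N. L (h j)) = L (\<lambda>x. \<Sum>j<N. h j x)"
      using h by (simp add: L_sum)
    also have "\<dots> \<le> L f"
      using sum_h by (intro L_mono f bounded_continuous_sum h) auto
    finally show "(\<integral>x. f x \<partial>M) \<le> L f + e" by simp
  qed
  have le: "(\<integral>x. f x \<partial>M) \<le> L f" if f: "f \<in> bounded_continuous \<Omega>" for f
  proof -
    obtain B where B: "\<And>x. x \<in> \<Omega> \<Longrightarrow> \<bar>f x\<bar> \<le> B"
      using f by (auto simp: bounded_continuous_iff)
    \<comment> \<open>The shift makes the function nonnegative and adds the same amount,
      \<open>B\<close> times L 1, to both sides.\<close>
    have "(\<integral>x. f x + B \<partial>M) \<le> L (\<lambda>x. f x + B)"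
      using B by (intro le_nonneg bounded_continuous_intros f) (smt (verit))
    also have "L (\<lambda>x. f x + B) = L f + B * L (\<lambda>x. 1)"
      using L_add[OF f, of "\<lambda>_. B"] L_scale[of "\<lambda>x. 1" B] by (simp add: bounded_continuous_const)
    also have "(\<integral>x. f x + B \<partial>M) = (\<integral>x. f x \<partial>M) + B * L (\<lambda>x. 1)"
      using int[OF f] by (simp add: total)
    finally show ?thesis by simp
  qed
  have eq: "(\<integral>x. f x \<partial>M) = L f" if f: "f \<in> bounded_continuous \<Omega>" for f
  proof (rule antisym[OF le[OF f]])
    have "(\<lambda>x. (-1) * f x) \<in> bounded_continuous \<Omega>"
      by (intro bounded_continuous_intros f)
    from le[OF this] L_scale[OF f, of "-1"] show "L f \<le> (\<integral>x. f x \<partial>M)"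
      by simp
  qed
  show thesis
    by (rule that[OF sets_M finite_measure_axioms int eq])
qed

end

section \<open>Subgradients of convex functions\<close>

definition sublinear_on :: "'v::real_vector set \<Rightarrow> ('v \<Rightarrow> real) \<Rightarrow> bool" where
  "sublinear_on S q \<longleftrightarrow> (\<forall>x\<in>S. \<forall>y\<in>S. q (x + y) \<le> q x + q y) \<and>
                      (\<forall>x\<in>S. \<forall>c>0. q (c *\<^sub>R x) \<le> c * q x)"

lemma sublinear_on_add: "sublinear_on S q \<Longrightarrow> x \<in> S \<Longrightarrow> y \<in> S \<Longrightarrow> q (x + y) \<le> q x + q y"
  by (simp add: sublinear_on_def)

text \<open>The assumed inequality for c > 0 turns around when applied with 1/c. For c = 0 the
  factors 2 and 1/2 together force \<open>q 0 = 0\<close>.\<close>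

lemma sublinear_on_scale:
  assumes "sublinear_on S q" "subspace S" "x \<in> S" "0 \<le> c"
  shows "q (c *\<^sub>R x) = c * q x"
proof -
  have le: "q (c *\<^sub>R x) \<le> c * q x" if "x \<in> S" "c > 0" for c x
    using assms that by (simp add: sublinear_on_def)
  show ?thesis
  proof (cases "c = 0")
    case True
    have "q 0 \<le> 2 * q 0" "q 0 \<le> (1/2) * q 0"
      using le[of 0 2] le[of 0 "1/2"] subspace_0[OF assms(2)] by simp_all
    with True show ?thesis by simp
  next
    case False
    with assms have c: "c > 0" by simp
    have "q ((1/c) *\<^sub>R (c *\<^sub>R x)) \<le> (1/c) * q (c *\<^sub>R x)"
      using c assms by (intro le subspace_mul) auto
    with c have "c * q x \<le> q (c *\<^sub>R x)" by (simp add: field_simps)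
    with le[OF assms(3) c] show ?thesis by simp
  qed
qed

lemma sublinear_on_minus:
  assumes "sublinear_on S q" "subspace S" "x \<in> S"
  shows "- q (- x) \<le> q x"
proof -
  have "q (x + - x) \<le> q x + q (- x)"
    using assms by (intro sublinear_on_add) (auto intro: subspace_neg)
  moreover have "q (0 *\<^sub>R x) = 0 * q x"
    using assms by (intro sublinear_on_scale) auto
  ultimately show ?thesis by simp
qed

text \<open>A minimal sublinear functional \<open>m\<close> is additive: \<open>x \<mapsto> inf\<^bsub>t\<ge>0\<^esub> (m (x + t a) - t m a)\<close> is
  sublinear and at most \<open>m\<close>, hence equal to \<open>m\<close>.\<close>
theorem sublinear_on_dominates_linear:
  fixes S :: "'v::real_vector set"
  assumes p: "sublinear_on S p" and S: "subspace S"
  obtains l where "\<And>x y. x \<in> S \<Longrightarrow> y \<in> S \<Longrightarrow> l (x + y) = l x + l y"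
    and "\<And>x c. x \<in> S \<Longrightarrow> l (c *\<^sub>R x) = c * l x"
    and "\<And>x. x \<in> S \<Longrightarrow> l x \<le> p x"
proof -
  \<comment> \<open>Fixing the value 0 off \<open>S\<close> reduces the pointwise order on the whole
    space to the order on \<open>S\<close>. The order \<open>ge\<close> is reversed so that Zorn's
    lemma yields a minimal functional.\<close>
  define A where "A = {q. sublinear_on S q \<and> (\<forall>x\<in>S. q x \<le> p x) \<and> (\<forall>x. x \<notin> S \<longrightarrow> q x = 0)}"
  define ge :: "('v \<Rightarrow> real) \<Rightarrow> ('v \<Rightarrow> real) \<Rightarrow> bool" where "ge q r \<longleftrightarrow> (\<forall>x. r x \<le> q x)" for q r
  \<comment> \<open>A bound common to all of \<open>A\<close>, so that chains have finite pointwise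
    infima.\<close>
  have lower: "- p (- x) \<le> q x" if "q \<in> A" "x \<in> S" for q x
    using that sublinear_on_minus[of S q x] S subspace_neg[OF S] by (fastforce simp: A_def)
  have "\<exists>m\<in>A. \<forall>q\<in>A. ge m q \<longrightarrow> q = m"
  proof (rule predicate_Zorn)
    show "partial_order_on A (relation_of ge A)"
      by (rule partial_order_on_relation_ofI) (auto simp: ge_def fun_eq_iff intro: order_trans antisym)
  next
    fix C assume C: "C \<in> Chains (relation_of ge A)"
    then have CA: "C \<subseteq> A" by (rule Chains_relation_of)
    show "\<exists>u\<in>A. \<forall>q\<in>C. ge q u"
    proof (cases "C = {}")
      case True
      have "(\<lambda>x. if x \<in> S then p x else 0) \<in> A"
        using p S by (auto simp: A_def sublinear_on_def subspace_add subspace_mul)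
      with True show ?thesis by blast
    next
      case False
      define u where "u x = (if x \<in> S then INF q\<in>C. q x else 0)" for x
      have bdd: "bdd_below ((\<lambda>q. q x) ` C)" if "x \<in> S" for x
        using lower[OF _ that] CA by (auto intro!: bdd_belowI2[of _ "- p (- x)"])
      have u_le: "u x \<le> q x" if "x \<in> S" "q \<in> C" for x q
        using that bdd by (auto simp: u_def intro: cINF_lower)
      have u_ge: "b \<le> u x" if "x \<in> S" "\<And>q. q \<in> C \<Longrightarrow> b \<le> q x" for x b
        using that False by (auto simp: u_def intro: cINF_greatest)
      have "sublinear_on S u"
        unfolding sublinear_on_def
      proof (intro conjI ballI allI impI)
        fix x y assume xy: "x \<in> S" "y \<in> S"
        have "u (x + y) \<le> q x + r y" if qr: "q \<in> C" "r \<in> C" for q r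
        proof -
          \<comment> \<open>In a chain, q and r can be replaced by the smaller of the two, whose own
            subadditivity then applies.\<close>
          have "ge q r \<or> ge r q"
            using C qr by (auto simp: Chains_def relation_of_def)
          then obtain s where s: "s \<in> C" "s x \<le> q x" "s y \<le> r y"
            using qr by (auto simp: ge_def)
          have "u (x + y) \<le> s (x + y)"
            using s xy S by (intro u_le) (auto intro: subspace_add)
          also have "\<dots> \<le> s x + s y"
            using s CA xy by (intro sublinear_on_add[of S]) (auto simp: A_def)
          finally show ?thesis using s by simp
        qed
        then have "u (x + y) - r y \<le> u x" if "r \<in> C" for r
          using that xy by (intro u_ge) (auto simp: diff_le_eq)
        then have "u (x + y) - u x \<le> u y"
          using xy by (intro u_ge) (auto simp: algebra_simps)
        then show "u (x + y) \<le> u x + u y" by simp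
      next
        fix x and c :: real assume x: "x \<in> S" and c: "0 < c"
        have "u (c *\<^sub>R x) / c \<le> u x"
        proof (rule u_ge[OF x])
          fix q assume q: "q \<in> C"
          have "u (c *\<^sub>R x) \<le> q (c *\<^sub>R x)"
            using q x S by (intro u_le) (auto intro: subspace_mul)
          also have "\<dots> \<le> c * q x"
            using q CA x c by (auto simp: A_def sublinear_on_def)
          finally show "u (c *\<^sub>R x) / c \<le> q x" using c by (simp add: field_simps)
        qed
        then show "u (c *\<^sub>R x) \<le> c * u x" using c by (simp add: field_simps)
      qed
      moreover have "u x \<le> p x" if "x \<in> S" for x
      proof -
        obtain q where "q \<in> C" using False by blast
        then show ?thesis
          using u_le[OF that] CA that by (force simp: A_def)
      qed
      ultimately have "u \<in> A" by (simp add: A_def u_def)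
      moreover have "ge q u" if "q \<in> C" for q
        using u_le[OF _ that] that CA by (auto simp: ge_def A_def u_def)
      ultimately show ?thesis by blast
    qed
  qed
  then obtain m where "m \<in> A" and min: "\<And>q. q \<in> A \<Longrightarrow> ge m q \<Longrightarrow> q = m" by blast
  then have m: "sublinear_on S m" "\<And>x. x \<in> S \<Longrightarrow> m x \<le> p x" "\<And>x. x \<notin> S \<Longrightarrow> m x = 0"
    by (auto simp: A_def)
  note m_scale = sublinear_on_scale[OF m(1) S]
  have superadd: "m x + m a \<le> m (x + a)" if x: "x \<in> S" and a: "a \<in> S" for x a
  proof -
    let ?f = "\<lambda>x t. m (x + t *\<^sub>R a) - t * m a"
    define q where "q x = (if x \<in> S then INF t\<in>{0..}. ?f x t else 0)" for x
    have inS: "x + t *\<^sub>R a \<in> S" if "x \<in> S" for x t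
      using S a that by (intro subspace_add subspace_mul)
    have bdd: "bdd_below (?f x ` {0..})" if x: "x \<in> S" for x
    proof (rule bdd_belowI2)
      fix t :: real assume t: "t \<in> {0..}"
      have "m ((x + t *\<^sub>R a) + - x) \<le> m (x + t *\<^sub>R a) + m (- x)"
        using x S inS by (intro sublinear_on_add[OF m(1)]) (auto intro: subspace_neg)
      then show "- m (- x) \<le> ?f x t"
        using m_scale[OF a, of t] t by simp
    qed
    have q_le: "q x \<le> ?f x t" if "x \<in> S" "0 \<le> t" for x t
      using that bdd by (auto simp: q_def intro!: cINF_lower[of _ "{0..}" t])
    have q_ge: "b \<le> q x" if "x \<in> S" "\<And>t. 0 \<le> t \<Longrightarrow> b \<le> ?f x t" for x b
      using that by (auto simp: q_def intro!: cINF_greatest)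
    have "sublinear_on S q"
      unfolding sublinear_on_def
    proof (intro conjI ballI allI impI)
      fix x y assume xy: "x \<in> S" "y \<in> S"
      have "q (x + y) \<le> ?f x s + ?f y t" if "0 \<le> s" "0 \<le> t" for s t
      proof -
        have "q (x + y) \<le> ?f (x + y) (s + t)"
          using that xy S by (intro q_le) (auto intro: subspace_add)
        moreover have "m ((x + s *\<^sub>R a) + (y + t *\<^sub>R a)) \<le> m (x + s *\<^sub>R a) + m (y + t *\<^sub>R a)"
          using xy inS by (intro sublinear_on_add[OF m(1)])
        moreover have "(x + s *\<^sub>R a) + (y + t *\<^sub>R a) = x + y + (s + t) *\<^sub>R a"
          by (simp add: algebra_simps)
        ultimately show ?thesis by (simp add: algebra_simps)
      qed
      then have "q (x + y) - ?f y t \<le> q x" if "0 \<le> t" for t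
        using that xy by (intro q_ge) (auto simp: diff_le_eq)
      then have "q (x + y) - q x \<le> q y"
        using xy by (intro q_ge) (auto simp: algebra_simps)
      then show "q (x + y) \<le> q x + q y" by simp
    next
      fix x and c :: real assume x: "x \<in> S" and c: "0 < c"
      have "q (c *\<^sub>R x) / c \<le> q x"
      proof (rule q_ge[OF x])
        fix t :: real assume t: "0 \<le> t"
        have "q (c *\<^sub>R x) \<le> ?f (c *\<^sub>R x) (c * t)"
          using t c x S by (intro q_le) (auto intro: subspace_mul)
        also have "c *\<^sub>R x + (c * t) *\<^sub>R a = c *\<^sub>R (x + t *\<^sub>R a)"
          by (simp add: algebra_simps)
        also have "m \<dots> = c * m (x + t *\<^sub>R a)"
          using inS x c by (intro m_scale) auto
        finally show "q (c *\<^sub>R x) / c \<le> ?f x t"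
          using c by (simp add: field_simps)
      qed
      then show "q (c *\<^sub>R x) \<le> c * q x" using c by (simp add: field_simps)
    qed
    moreover have q_m: "q x \<le> m x" for x
      using q_le[of x 0] m(3)[of x] by (cases "x \<in> S") (auto simp: q_def)
    moreover have "q x \<le> p x" if "x \<in> S" for x
      using q_m[of x] m(2)[OF that] by linarith
    ultimately have "q \<in> A" "ge m q"
      by (auto simp: A_def ge_def q_def)
    then have "q = m" by (rule min)
    \<comment> \<open>At t = 1 the identity q = m gives m x \<le> m (x + a) - m a.\<close>
    with q_le[OF x, of 1] show ?thesis by simp
  qed
  have add: "m (x + y) = m x + m y" if "x \<in> S" "y \<in> S" for x y
    using superadd[OF that] sublinear_on_add[OF m(1) that] by simp
  moreover have "m (c *\<^sub>R x) = c * m x" if x: "x \<in> S" for x c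
  proof (cases "0 \<le> c")
    case False
    have "m (c *\<^sub>R x) + m ((- c) *\<^sub>R x) = m (c *\<^sub>R x + (- c) *\<^sub>R x)"
      using x S by (intro add[symmetric] subspace_mul)
    also have "\<dots> = 0"
      using m_scale[OF x, of 0] by simp
    finally show ?thesis
      using m_scale[OF x, of "- c"] False by simp
  qed (simp add: m_scale x)
  ultimately show thesis
    using m(2) by (rule that)
qed

text \<open>The directional derivative \<open>v \<mapsto> inf\<^bsub>t>0\<^esub> (f (x + t v) - f x) / t\<close> is sublinear.\<close>
theorem convex_on_subgradient:
  fixes f :: "'v::real_vector \<Rightarrow> real"
  assumes f: "convex_on S f" and S: "subspace S" and x: "x \<in> S"
  obtains l where "\<And>x y. x \<in> S \<Longrightarrow> y \<in> S \<Longrightarrow> l (x + y) = l x + l y"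
    and "\<And>x c. x \<in> S \<Longrightarrow> l (c *\<^sub>R x) = c * l x"
    and "\<And>y. y \<in> S \<Longrightarrow> l (y - x) \<le> f y - f x"
proof -
  let ?d = "\<lambda>v t. (f (x + t *\<^sub>R v) - f x) / t"
  define p where "p v = (INF t\<in>{0<..}. ?d v t)" for v
  have inS: "x + t *\<^sub>R v \<in> S" if "v \<in> S" for t v
    using S x that by (intro subspace_add subspace_mul)
  have bdd: "bdd_below (?d v ` {0<..})" if v: "v \<in> S" for v
  proof (rule bdd_belowI2)
    fix t :: real assume "t \<in> {0<..}"
    then have t: "0 < t" by simp
    \<comment> \<open>The weight that makes \<open>x\<close> a convex combination of x + t v and x -
      v; every quotient is thus at least the backward slope f x - f (x - v).\<close>
    define u where "u = 1 / (1 + t)"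
    have u: "0 \<le> u" "0 \<le> 1 - u" "u + (1 - u) = 1" "1 - u = t * u"
      using t by (auto simp: u_def field_simps)
    have "x = u *\<^sub>R (x + t *\<^sub>R v) + (1 - u) *\<^sub>R (x + (-1) *\<^sub>R v)"
    proof -
      have "(u * t) *\<^sub>R v = v - u *\<^sub>R v"
        using u(4) by (metis mult.commute scaleR_left_diff_distrib scaleR_one)
      then show ?thesis
        by (simp add: scaleR_left_diff_distrib scaleR_right_diff_distrib scaleR_add_right)
    qed
    then have "f x \<le> u * f (x + t *\<^sub>R v) + (1 - u) * f (x + (-1) *\<^sub>R v)"
      using f u inS[OF v] unfolding convex_on_def by metis
    also have "\<dots> = (f (x + t *\<^sub>R v) + t * f (x + (-1) *\<^sub>R v)) / (1 + t)"
      unfolding u(4) by (simp add: u_def add_divide_distrib)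
    finally have "f x * (1 + t) \<le> f (x + t *\<^sub>R v) + t * f (x + (-1) *\<^sub>R v)"
      using t by (simp add: pos_le_divide_eq)
    then show "f x - f (x + (-1) *\<^sub>R v) \<le> ?d v t"
      using t by (simp add: field_simps)
  qed
  have p_le: "p v \<le> ?d v t" if "v \<in> S" "0 < t" for v t
    using that bdd unfolding p_def by (intro cINF_lower) auto
  have p_ge: "b \<le> p v" if "\<And>t. 0 < t \<Longrightarrow> b \<le> ?d v t" for v b
    using that unfolding p_def by (intro cINF_greatest) auto
  have "sublinear_on S p"
    unfolding sublinear_on_def
  proof (intro conjI ballI allI impI)
    fix v w assume vw: "v \<in> S" "w \<in> S"
    have "p (v + w) \<le> ?d v s + ?d w t" if s: "0 < s" and t: "0 < t" for s t
    proof -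
      \<comment> \<open>Here r = s t / (s + t), the step at which x + r (v + w) meets the segment
        from x + s v to x + t w. It turns the weights into u / r = 1 / s and (1 - u) / r = 1 / t, so
        the two quotients separate.\<close>
      define u r where "u = t / (s + t)" and "r = s * u"
      have "1 - u = s / (s + t)"
        using s t by (simp add: u_def field_simps)
      then have u: "0 \<le> u" "0 \<le> 1 - u" "u + (1 - u) = 1" "r = (1 - u) * t" and r: "0 < r"
        using s t by (simp_all add: u_def r_def)
      have "x + r *\<^sub>R (v + w) = u *\<^sub>R (x + s *\<^sub>R v) + (1 - u) *\<^sub>R (x + t *\<^sub>R w)"
        unfolding scaleR_add_right scaleR_scaleR u(4)[symmetric] using r_def by (simp add: algebra_simps)
      then have "f (x + r *\<^sub>R (v + w)) \<le> u * f (x + s *\<^sub>R v) + (1 - u) * f (x + t *\<^sub>R w)"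
        using f u inS vw unfolding convex_on_def by metis
      then have "f (x + r *\<^sub>R (v + w)) - f x \<le> u * (f (x + s *\<^sub>R v) - f x) + (1 - u) * (f (x + t *\<^sub>R w) - f x)"
        by (simp add: algebra_simps)
      then have "?d (v + w) r \<le> (u * (f (x + s *\<^sub>R v) - f x) + (1 - u) * (f (x + t *\<^sub>R w) - f x)) / r"
        using r by (simp add: divide_right_mono)
      also have "\<dots> = (u / r) * (f (x + s *\<^sub>R v) - f x) + ((1 - u) / r) * (f (x + t *\<^sub>R w) - f x)"
        by (simp add: add_divide_distrib)
      also have "u / r = 1 / s"
        using s t by (simp add: u_def r_def)
      also have "(1 - u) / r = 1 / t"
        using r by (auto simp: u(4))
      finally show ?thesis
        using p_le[of "v + w" r] r vw S subspace_add by fastforce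
    qed
    then have "p (v + w) - ?d w t \<le> p v" if "0 < t" for t
      using that by (intro p_ge) (auto simp: diff_le_eq)
    then have "p (v + w) - p v \<le> p w"
      by (intro p_ge) (auto simp: algebra_simps)
    then show "p (v + w) \<le> p v + p w" by simp
  next
    fix v and c :: real assume v: "v \<in> S" and c: "0 < c"
    have "p (c *\<^sub>R v) / c \<le> p v"
    proof (rule p_ge)
      fix t :: real assume t: "0 < t"
      have "p (c *\<^sub>R v) \<le> ?d (c *\<^sub>R v) (t / c)"
        using t c v S by (intro p_le) (auto intro: subspace_mul)
      then show "p (c *\<^sub>R v) / c \<le> ?d v t"
        using c t by (simp add: field_simps)
    qed
    then show "p (c *\<^sub>R v) \<le> c * p v" using c by (simp add: field_simps)
  qed
  then show thesis
  proof (rule sublinear_on_dominates_linear[OF _ S])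
    fix l :: "'v \<Rightarrow> real"
    assume l: "\<And>x y. x \<in> S \<Longrightarrow> y \<in> S \<Longrightarrow> l (x + y) = l x + l y"
      "\<And>x c. x \<in> S \<Longrightarrow> l (c *\<^sub>R x) = c * l x" and le: "\<And>x. x \<in> S \<Longrightarrow> l x \<le> p x"
    have "l (y - x) \<le> f y - f x" if "y \<in> S" for y
      using le[of "y - x"] p_le[of "y - x" 1] subspace_diff[OF S that x] by simp
    with l show thesis by (rule that)
  qed
qed

text \<open>Pointwise scaling allows \<open>subspace\<close>, \<open>convex_on\<close> and the
  subgradient theorem to be used for spaces of functions.\<close>

instantiation "fun" :: (type, real_vector) real_vector
begin

definition "scaleR r f = (\<lambda>x. r *\<^sub>R f x)"

instance
  by standard (simp_all add: scaleR_fun_def fun_eq_iff algebra_simps)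

end

section \<open>Weighted spaces of continuous and semicontinuous functions\<close>

lemma C_Z_subset_U_Z: "C_Z \<Omega> Z \<subseteq> U_Z \<Omega> Z"
proof -
  have "usc_on \<Omega> X" if "continuous_on \<Omega> X" for X :: "'a \<Rightarrow> real"
  proof -
    have "{x \<in> \<Omega>. X x < y} = \<Omega> \<inter> X -` {..<y}" for y by auto
    then show ?thesis
      using that by (simp add: usc_on_def continuous_openin_preimage_gen)
  qed
  then show ?thesis by (auto simp: C_Z_def U_Z_def)
qed

lemma usc_on_borel_measurable:
  assumes "usc_on \<Omega> X"
  shows "X \<in> borel_measurable (restrict_space borel \<Omega>)"
  unfolding borel_measurable_iff_less
proof
  fix y
  obtain T where "open T" "{x\<in>\<Omega>. X x < y} = \<Omega> \<inter> T"
    using assms by (auto simp: usc_on_def openin_open)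
  then show "{x \<in> space (restrict_space borel \<Omega>). X x < y} \<in> sets (restrict_space borel \<Omega>)"
    by (auto simp: space_restrict_space sets_restrict_space)
qed

locale weighted_space =
  fixes \<Omega> :: "'a::metric_space set" and Z :: "'a \<Rightarrow> real"
  assumes Z_cont: "continuous_on \<Omega> Z"
    and Z_ge1: "\<And>x. x \<in> \<Omega> \<Longrightarrow> 1 \<le> Z x"
    and Z_compact: "\<And>z. 0 \<le> z \<Longrightarrow> compact {x\<in>\<Omega>. Z x \<le> z}"
begin

text \<open>Members of \<open>C_Z\<close> must vanish off \<Omega>, where \<open>Z\<close> and
  formulas built from it are arbitrary; this truncation restores the convention.\<close>

definition zero_off :: "('a \<Rightarrow> real) \<Rightarrow> 'a \<Rightarrow> real" where
  "zero_off f = (\<lambda>x. if x \<in> \<Omega> then f x else 0)"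

lemma Z_pos: "x \<in> \<Omega> \<Longrightarrow> 0 < Z x"
  using Z_ge1[of x] by simp

lemma Z_boundedI:
  assumes "\<And>x. x \<in> \<Omega> \<Longrightarrow> \<bar>W x\<bar> \<le> c * Z x"
  shows "Z_bounded \<Omega> Z W"
  unfolding Z_bounded_def
proof (intro exI ballI)
  fix x assume x: "x \<in> \<Omega>"
  show "\<bar>W x / Z x\<bar> \<le> c"
    using assms[OF x] Z_pos[OF x] by (simp add: field_simps)
qed

lemma Z_boundedE:
  assumes "Z_bounded \<Omega> Z W"
  obtains c where "0 \<le> c" "\<And>x. x \<in> \<Omega> \<Longrightarrow> \<bar>W x\<bar> \<le> c * Z x"
proof -
  obtain c where c: "\<And>x. x \<in> \<Omega> \<Longrightarrow> \<bar>W x / Z x\<bar> \<le> c"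
    using assms by (auto simp: Z_bounded_def)
  have "\<bar>W x\<bar> \<le> max c 0 * Z x" if x: "x \<in> \<Omega>" for x
  proof -
    have "\<bar>W x\<bar> \<le> c * Z x"
      using c[OF x] Z_pos[OF x] by (simp add: field_simps)
    also have "\<dots> \<le> max c 0 * Z x"
      using Z_pos[OF x] by (intro mult_right_mono) auto
    finally show ?thesis .
  qed
  then show thesis by (intro that[of "max c 0"]) auto
qed

lemma Z_bounded_add:
  assumes "Z_bounded \<Omega> Z V" "Z_bounded \<Omega> Z W"
  shows "Z_bounded \<Omega> Z (V + W)"
proof -
  obtain c where c: "\<And>x. x \<in> \<Omega> \<Longrightarrow> \<bar>V x\<bar> \<le> c * Z x"
    using assms(1) by (rule Z_boundedE) blast
  obtain d where d: "\<And>x. x \<in> \<Omega> \<Longrightarrow> \<bar>W x\<bar> \<le> d * Z x"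
    using assms(2) by (rule Z_boundedE) blast
  show ?thesis
  proof (rule Z_boundedI)
    fix x assume "x \<in> \<Omega>"
    from c[OF this] d[OF this] show "\<bar>(V + W) x\<bar> \<le> (c + d) * Z x"
      unfolding plus_fun_apply distrib_right by linarith
  qed
qed

lemma Z_bounded_scaleR:
  assumes "Z_bounded \<Omega> Z W"
  shows "Z_bounded \<Omega> Z (a *\<^sub>R W)"
proof -
  obtain c where "\<And>x. x \<in> \<Omega> \<Longrightarrow> \<bar>W x\<bar> \<le> c * Z x"
    using assms by (rule Z_boundedE) blast
  then show ?thesis
    by (intro Z_boundedI[of _ "\<bar>a\<bar> * c"]) (simp add: scaleR_fun_def abs_mult mult.assoc mult_left_mono)
qed

text \<open>Unlike \<open>U_Z\<close>, this space contains differences of its members. It is the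
  domain on which subgradients of \<open>upper\<close> are taken.\<close>

lemma subspace_Z_bounded: "subspace {W. Z_bounded \<Omega> Z W}"
  by (auto simp: subspace_def Z_bounded_add Z_bounded_scaleR intro: Z_boundedI[of _ 0])

lemma Z_bounded_diff: "Z_bounded \<Omega> Z V \<Longrightarrow> Z_bounded \<Omega> Z W \<Longrightarrow> Z_bounded \<Omega> Z (V - W)"
  using subspace_diff[OF subspace_Z_bounded] by simp

lemma Z_bounded_Z: "Z_bounded \<Omega> Z Z"
  using Z_pos by (intro Z_boundedI[of _ 1]) (simp add: abs_of_pos)

lemma C_ZI:
  assumes "continuous_on \<Omega> f" "Z_bounded \<Omega> Z f"
  shows "zero_off f \<in> C_Z \<Omega> Z"
proof -
  have "continuous_on \<Omega> (zero_off f) \<longleftrightarrow> continuous_on \<Omega> f"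
    by (rule continuous_on_cong) (auto simp: zero_off_def)
  with assms show ?thesis
    by (auto simp: C_Z_def Z_bounded_def zero_off_def)
qed

lemma C_Z_D: "Y \<in> C_Z \<Omega> Z \<Longrightarrow> continuous_on \<Omega> Y" "Y \<in> C_Z \<Omega> Z \<Longrightarrow> Z_bounded \<Omega> Z Y"
  by (simp_all add: C_Z_def)

lemma U_Z_D: "Y \<in> U_Z \<Omega> Z \<Longrightarrow> usc_on \<Omega> Y" "Y \<in> U_Z \<Omega> Z \<Longrightarrow> Z_bounded \<Omega> Z Y"
  by (simp_all add: U_Z_def)

lemma C_Z_combination:
  assumes "V \<in> C_Z \<Omega> Z" "W \<in> C_Z \<Omega> Z"
  shows "(\<lambda>x. a * V x + b * W x) \<in> C_Z \<Omega> Z"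
proof -
  have "Z_bounded \<Omega> Z (a *\<^sub>R V + b *\<^sub>R W)"
    using assms by (intro Z_bounded_add Z_bounded_scaleR C_Z_D)
  then show ?thesis
    using assms by (auto simp: C_Z_def scaleR_fun_def plus_fun_def intro!: continuous_intros)
qed

lemma C_Z_max:
  assumes "V \<in> C_Z \<Omega> Z" "W \<in> C_Z \<Omega> Z"
  shows "(\<lambda>x. max (V x) (W x)) \<in> C_Z \<Omega> Z"
proof -
  obtain c where c: "0 \<le> c" "\<And>x. x \<in> \<Omega> \<Longrightarrow> \<bar>V x\<bar> \<le> c * Z x"
    using C_Z_D(2)[OF assms(1)] by (rule Z_boundedE) blast
  obtain d where d: "0 \<le> d" "\<And>x. x \<in> \<Omega> \<Longrightarrow> \<bar>W x\<bar> \<le> d * Z x"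
    using C_Z_D(2)[OF assms(2)] by (rule Z_boundedE) blast
  have "Z_bounded \<Omega> Z (\<lambda>x. max (V x) (W x))"
  proof (rule Z_boundedI)
    fix x assume x: "x \<in> \<Omega>"
    have "0 \<le> c * Z x" "0 \<le> d * Z x"
      using c(1) d(1) Z_pos[OF x] by simp_all
    with c(2)[OF x] d(2)[OF x] show "\<bar>max (V x) (W x)\<bar> \<le> (c + d) * Z x"
      unfolding distrib_right by linarith
  qed
  with assms show ?thesis
    by (auto simp: C_Z_def intro!: continuous_on_max)
qed

lemma pospart_shift_C_Z:
  assumes "0 \<le> z"
  shows "pospart_shift \<Omega> Z z \<in> C_Z \<Omega> Z"
proof -
  have "zero_off (\<lambda>x. max (Z x - z) 0) \<in> C_Z \<Omega> Z"
    using assms Z_pos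
    by (intro C_ZI continuous_intros Z_cont Z_boundedI[of _ 1]) (auto simp: abs_of_nonneg max_def less_imp_le)
  then show ?thesis
    by (simp add: pospart_shift_def zero_off_def)
qed

text \<open>The Lipschitz regularizations \<open>x \<mapsto> inf\<^sub>y (f y + n d(x,y))\<close> increase to the nonnegative
  lower semicontinuous function \<open>f = c Z - X\<close>.\<close>
lemma U_Z_approx:
  assumes X: "X \<in> U_Z \<Omega> Z"
  obtains Xs and c :: real where "\<And>n::nat. Xs n \<in> C_Z \<Omega> Z"
    "\<And>x. x \<in> \<Omega> \<Longrightarrow> decseq (\<lambda>n. Xs n x)" "\<And>x. x \<in> \<Omega> \<Longrightarrow> (\<lambda>n. Xs n x) \<longlonglongrightarrow> X x"
    "\<And>n x. x \<in> \<Omega> \<Longrightarrow> \<bar>Xs n x\<bar> \<le> c * Z x"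
proof -
  obtain c where c: "0 \<le> c" "\<And>x. x \<in> \<Omega> \<Longrightarrow> \<bar>X x\<bar> \<le> c * Z x"
    using U_Z_D(2)[OF X] by (rule Z_boundedE) blast
  define f where "f x = c * Z x - X x" for x
  have f0: "0 \<le> f x" if "x \<in> \<Omega>" for x
    using c(2)[OF that] by (simp add: f_def abs_le_iff)
  define F where "F n x = (INF y\<in>\<Omega>. f y + real n * dist x y)" for n :: nat and x
  have F_le: "F n x \<le> f y + real n * dist x y" if "y \<in> \<Omega>" for n x y
    unfolding F_def using that f0 by (intro cINF_lower bdd_belowI2[of _ 0]) (auto intro: add_nonneg_nonneg)
  have F_ge: "b \<le> F n x" if "x \<in> \<Omega>" "\<And>y. y \<in> \<Omega> \<Longrightarrow> b \<le> f y + real n * dist x y" for b n x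
    unfolding F_def using that by (intro cINF_greatest) auto
  have F_f: "F n x \<le> f x" if "x \<in> \<Omega>" for n x
    using F_le[OF that, of n x] by simp
  have F_0: "0 \<le> F n x" if "x \<in> \<Omega>" for n x
    using that f0 by (intro F_ge) auto
  have F_mono: "F n x \<le> F (Suc n) x" if "x \<in> \<Omega>" for n x
  proof (rule F_ge[OF that])
    fix y assume "y \<in> \<Omega>"
    from F_le[OF this, of n x] show "F n x \<le> f y + real (Suc n) * dist x y"
      using zero_le_dist[of x y] unfolding of_nat_Suc distrib_right by linarith
  qed
  have lip: "F n x \<le> F n x' + real n * dist x x'" if x: "x \<in> \<Omega>" "x' \<in> \<Omega>" for n x x'
  proof -
    have "F n x - real n * dist x x' \<le> F n x'"
    proof (rule F_ge[OF x(2)])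
      fix y assume y: "y \<in> \<Omega>"
      have "real n * dist x y \<le> real n * (dist x x' + dist x' y)"
        by (intro mult_left_mono dist_triangle) auto
      with F_le[OF y, of n x] show "F n x - real n * dist x x' \<le> f y + real n * dist x' y"
        by (simp add: distrib_left)
    qed
    then show ?thesis by simp
  qed
  have F_cont: "continuous_on \<Omega> (F n)" for n
  proof (rule lipschitz_on_continuous_on)
    show "(real n)-lipschitz_on \<Omega> (F n)"
    proof (rule lipschitz_onI)
      fix x y assume "x \<in> \<Omega>" "y \<in> \<Omega>"
      with lip[of x y n] lip[of y x n] show "dist (F n x) (F n y) \<le> real n * dist x y"
        by (simp add: dist_real_def dist_commute abs_le_iff)
    qed simp
  qed
  have F_lim: "(\<lambda>n. F n x) \<longlonglongrightarrow> f x" if x: "x \<in> \<Omega>" for x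
  proof (rule increasing_tendsto)
    show "\<forall>\<^sub>F n in sequentially. F n x \<le> f x" using F_f[OF x] by simp
    fix r assume "r < f x"
    then obtain s where s: "r < s" "s < f x" using dense by blast
    \<comment> \<open>Near \<open>x\<close>, on \<open>?S\<close>, the function \<open>X\<close>
      rises by less than \<open>e\<close> and c Z drops by less than \<open>e\<close>, so
      \<open>f\<close> stays above f x - 2 e = s.\<close>
    define e where "e = (f x - s) / 2"
    have e: "0 < e" using s by (simp add: e_def)
    let ?S = "{y\<in>\<Omega>. X y < X x + e} \<inter> (\<Omega> \<inter> (\<lambda>y. c * Z y) -` {c * Z x - e<..})"
    have "openin (top_of_set \<Omega>) ?S"
      using X Z_cont by (intro openin_Int continuous_openin_preimage_gen continuous_intros)
        (auto simp: U_Z_def usc_on_def)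
    moreover have "x \<in> ?S" using x e by simp
    ultimately obtain d where "0 < d" "\<forall>y\<in>\<Omega>. dist y x < d \<longrightarrow> y \<in> ?S"
      unfolding openin_euclidean_subtopology_iff by blast
    then have d: "0 < d" "\<And>y. y \<in> \<Omega> \<Longrightarrow> dist y x < d \<Longrightarrow> X y < X x + e \<and> c * Z x - e < c * Z y"
      by auto
    \<comment> \<open>At points of distance at least \<open>d\<close> the penalty alone exceeds
      \<open>s\<close>, since \<open>f\<close> is nonnegative.\<close>
    obtain N :: nat where N: "s < real N * d"
      using reals_Archimedean3[OF d(1)] by blast
    have "s \<le> F n x" if n: "N \<le> n" for n
    proof (rule F_ge[OF x])
      fix y assume y: "y \<in> \<Omega>"
      show "s \<le> f y + real n * dist x y"
      proof (cases "dist y x < d")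
        case True
        have "s \<le> f y"
          using d(2)[OF y True] by (simp add: e_def f_def field_simps)
        then show ?thesis by (simp add: add_increasing2)
      next
        case False
        have "real N * d \<le> real n * dist x y"
          using n d(1) False by (intro mult_mono) (auto simp: dist_commute)
        with N f0[OF y] show ?thesis by simp
      qed
    qed
    with s(1) show "\<forall>\<^sub>F n in sequentially. r < F n x"
      by (auto simp: eventually_sequentially intro: less_le_trans)
  qed
  let ?X = "\<lambda>n. zero_off (\<lambda>x. c * Z x - F n x)"
  \<comment> \<open>From 0 \<le> F n \<le> f one gets X \<le> c Z - F n \<le> c Z. The bound is
    uniform in \<open>n\<close> and serves later as the integrable majorant for dominated
    convergence.\<close>
  have bnd: "\<bar>c * Z x - F n x\<bar> \<le> c * Z x" if x: "x \<in> \<Omega>" for n x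
  proof -
    have "X x \<le> c * Z x - F n x"
      using F_f[OF x, of n] by (simp add: f_def)
    with c(2)[OF x] F_0[OF x, of n] show ?thesis by (simp add: abs_le_iff)
  qed
  show thesis
  proof (rule that[of ?X c])
    show "?X n \<in> C_Z \<Omega> Z" for n
      using bnd by (intro C_ZI Z_boundedI continuous_intros Z_cont F_cont)
    show "decseq (\<lambda>n. ?X n x)" if "x \<in> \<Omega>" for x
      using F_mono[OF that] that by (intro decseq_SucI) (simp add: zero_off_def)
    show "(\<lambda>n. ?X n x) \<longlonglongrightarrow> X x" if "x \<in> \<Omega>" for x
    proof -
      have "(\<lambda>n. c * Z x - F n x) \<longlonglongrightarrow> c * Z x - f x"
        by (intro tendsto_intros F_lim that)
      with that show ?thesis by (simp add: zero_off_def f_def)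
    qed
    show "\<bar>?X n x\<bar> \<le> c * Z x" if "x \<in> \<Omega>" for n x
      using bnd[OF that] that by (simp add: zero_off_def)
  qed
qed

section \<open>Measures integrating \<open>Z\<close>, and a weighted form of Dini's theorem\<close>

lemma ca_Z_space: "M \<in> ca_Z \<Omega> Z \<Longrightarrow> space M = \<Omega>"
  using sets_eq_imp_space_eq[of M "restrict_space borel \<Omega>"] by (simp add: ca_Z_def space_restrict_space)

lemma ca_Z_measurable:
  assumes "M \<in> ca_Z \<Omega> Z" "X \<in> borel_measurable (restrict_space borel \<Omega>)"
  shows "X \<in> borel_measurable M"
  using assms by (simp add: ca_Z_def cong: measurable_cong_sets)

lemma ca_Z_integrable_Z:
  assumes "M \<in> ca_Z \<Omega> Z"
  shows "integrable M Z"
proof (rule integrableI_nonneg)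
  show "Z \<in> borel_measurable M"
    by (rule ca_Z_measurable[OF assms borel_measurable_continuous_on_restrict[OF Z_cont]])
  show "AE x in M. 0 \<le> Z x"
    using Z_pos ca_Z_space[OF assms] by (auto simp: less_imp_le)
qed (use assms in \<open>simp add: ca_Z_def\<close>)

lemma ca_Z_integrable:
  assumes M: "M \<in> ca_Z \<Omega> Z" and X: "X \<in> U_Z \<Omega> Z"
  shows "integrable M X"
proof -
  obtain c where c: "\<And>x. x \<in> \<Omega> \<Longrightarrow> \<bar>X x\<bar> \<le> c * Z x"
    using U_Z_D(2)[OF X] by (rule Z_boundedE) blast
  show ?thesis
  proof (rule Bochner_Integration.integrable_bound)
    show "integrable M (\<lambda>x. c * Z x)"
      by (intro integrable_mult_right ca_Z_integrable_Z M)
    show "X \<in> borel_measurable M"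
      using M usc_on_borel_measurable[OF U_Z_D(1)[OF X]] by (rule ca_Z_measurable)
    show "AE x in M. norm (X x) \<le> norm (c * Z x)"
      using c by (intro AE_I2) (auto simp: ca_Z_space[OF M] intro: order_trans[OF _ abs_ge_self])
  qed
qed

lemma pairing_mono:
  assumes M: "M \<in> ca_Z \<Omega> Z" and "X \<in> U_Z \<Omega> Z" "Y \<in> U_Z \<Omega> Z" "\<And>x. x \<in> \<Omega> \<Longrightarrow> X x \<le> Y x"
  shows "pairing X M \<le> pairing Y M"
  unfolding pairing_def using assms by (intro integral_mono ca_Z_integrable) (auto simp: ca_Z_space)

text \<open>On the compact set {Z \<le> 2 z} this is Dini's theorem, with e \<le> e Z because Z
  \<ge> 1. Off that set Z \<le> 2 (Z - z), so the initial bound c Z is absorbed by the second term;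
  this explains both factors 2.\<close>

lemma Dini_weighted:
  assumes cont: "\<And>n::nat. continuous_on \<Omega> (W n)"
    and dec: "\<And>x. x \<in> \<Omega> \<Longrightarrow> decseq (\<lambda>n. W n x)"
    and lim: "\<And>x. x \<in> \<Omega> \<Longrightarrow> (\<lambda>n. W n x) \<longlonglongrightarrow> 0"
    and W0: "\<And>x. x \<in> \<Omega> \<Longrightarrow> W 0 x \<le> c * Z x" and "0 \<le> c" "0 \<le> z" "0 < e"
  shows "\<exists>n. \<forall>x\<in>\<Omega>. W n x \<le> e * Z x + 2 * c * pospart_shift \<Omega> Z z x"
proof -
  let ?K = "{x\<in>\<Omega>. Z x \<le> 2 * z}"
  let ?U = "\<lambda>n. {x\<in>?K. W n x < e}"
  have K: "compact ?K" using \<open>0 \<le> z\<close> by (intro Z_compact) simp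
  moreover have "openin (top_of_set ?K) (?U n)" for n
  proof -
    have "?U n = ?K \<inter> W n -` {..<e}" by auto
    moreover have "continuous_on ?K (W n)"
      by (rule continuous_on_subset[OF cont]) auto
    ultimately show ?thesis
      by (simp only: continuous_openin_preimage_gen open_lessThan)
  qed
  moreover have "?K \<subseteq> \<Union> (range ?U)"
  proof
    fix x assume x: "x \<in> ?K"
    then have "\<forall>\<^sub>F n in sequentially. W n x < e"
      using \<open>0 < e\<close> by (intro order_tendstoD(2)[OF lim]) auto
    then obtain n where "W n x < e" by (auto simp: eventually_sequentially)
    with x show "x \<in> \<Union> (range ?U)" by auto
  qed
  ultimately obtain D where D: "D \<subseteq> range ?U" "finite D" "?K \<subseteq> \<Union> D"
    using K[unfolded compact_eq_openin_cover, rule_format, of "range ?U"] by blast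
  then obtain I where I: "finite I" "D = ?U ` I"
    by (meson finite_subset_image)
  obtain n where n: "\<And>i. i \<in> I \<Longrightarrow> i \<le> n"
    using I(1) by (meson finite_nat_set_iff_bounded_le)
  have le: "W n x \<le> W i x" if "x \<in> \<Omega>" "i \<le> n" for i x
    using dec[OF that(1)] that(2) by (simp add: decseq_def)
  have "W n x \<le> e * Z x + 2 * c * pospart_shift \<Omega> Z z x" if x: "x \<in> \<Omega>" for x
  proof (cases "Z x \<le> 2 * z")
    case True
    then obtain i where "i \<in> I" "W i x < e"
      using D(3) I x by blast
    then have "W n x \<le> e" using le[OF x n] by fastforce
    also have "e \<le> e * Z x" using Z_ge1[OF x] \<open>0 < e\<close> by simp
    finally show ?thesis
      using \<open>0 \<le> c\<close> by (simp add: pospart_shift_def add_increasing2)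
  next
    case False
    have "W n x \<le> c * Z x" using le[OF x, of 0] W0[OF x] by simp
    also have "\<dots> \<le> c * (2 * pospart_shift \<Omega> Z z x)"
      using \<open>0 \<le> c\<close> \<open>0 \<le> z\<close> False x by (intro mult_left_mono) (simp_all add: pospart_shift_def)
    finally show ?thesis
      using Z_pos[OF x] \<open>0 < e\<close> by (simp add: add_increasing)
  qed
  then show ?thesis by blast
qed

end

section \<open>The regularization of \<psi> by continuous majorants\<close>

locale increasing_convex_functional = weighted_space +
  fixes \<psi> :: "('a \<Rightarrow> real) \<Rightarrow> real"
  assumes incr: "increasing_on (U_Z \<Omega> Z) \<Omega> \<psi>"
    and convex: "convex_functional_on (U_Z \<Omega> Z) \<psi>"
    and lim: "\<And>n::nat. ((\<lambda>z::real. \<psi> (\<lambda>w. real n * pospart_shift \<Omega> Z z w)) \<longlongrightarrow> \<psi> (\<lambda>_. 0)) at_top"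
begin

lemma \<psi>_mono: "X \<in> U_Z \<Omega> Z \<Longrightarrow> Y \<in> U_Z \<Omega> Z \<Longrightarrow> (\<And>x. x \<in> \<Omega> \<Longrightarrow> X x \<le> Y x) \<Longrightarrow> \<psi> X \<le> \<psi> Y"
  using incr by (simp add: increasing_on_def)

definition majorants :: "('a \<Rightarrow> real) \<Rightarrow> ('a \<Rightarrow> real) set" where
  "majorants W = {Y\<in>C_Z \<Omega> Z. \<forall>x\<in>\<Omega>. W x \<le> Y x}"

definition upper :: "('a \<Rightarrow> real) \<Rightarrow> real" where
  "upper W = (INF Y\<in>majorants W. \<psi> Y)"

text \<open>The majorant c Z and, in \<open>bdd_below_majorants\<close>, the common minorant - c Z
  ensure that the real infimum defining \<open>upper\<close> is over a nonempty set bounded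
  below.\<close>

lemma majorants_nonempty:
  assumes "Z_bounded \<Omega> Z W"
  shows "majorants W \<noteq> {}"
proof -
  obtain c where c: "\<And>x. x \<in> \<Omega> \<Longrightarrow> \<bar>W x\<bar> \<le> c * Z x"
    using assms by (rule Z_boundedE) blast
  have "zero_off (c *\<^sub>R Z) \<in> C_Z \<Omega> Z"
    by (intro C_ZI Z_bounded_scaleR Z_bounded_Z) (simp add: scaleR_fun_def continuous_intros Z_cont)
  then have "zero_off (c *\<^sub>R Z) \<in> majorants W"
    using c by (auto simp: majorants_def zero_off_def scaleR_fun_def abs_le_iff)
  then show ?thesis by blast
qed

lemma bdd_below_majorants:
  assumes "Z_bounded \<Omega> Z W"
  shows "bdd_below (\<psi> ` majorants W)"
proof -
  obtain c where c: "\<And>x. x \<in> \<Omega> \<Longrightarrow> \<bar>W x\<bar> \<le> c * Z x"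
    using assms by (rule Z_boundedE) blast
  let ?m = "zero_off ((- c) *\<^sub>R Z)"
  have m: "?m \<in> C_Z \<Omega> Z"
    by (intro C_ZI Z_bounded_scaleR Z_bounded_Z) (simp add: scaleR_fun_def continuous_intros Z_cont)
  show ?thesis
  proof (rule bdd_belowI2)
    fix Y assume Y: "Y \<in> majorants W"
    have "?m x \<le> Y x" if "x \<in> \<Omega>" for x
      using c[OF that] Y that by (force simp: majorants_def zero_off_def scaleR_fun_def abs_le_iff)
    then show "\<psi> ?m \<le> \<psi> Y"
      using m Y C_Z_subset_U_Z by (intro \<psi>_mono) (auto simp: majorants_def)
  qed
qed

lemma upper_le: "Z_bounded \<Omega> Z W \<Longrightarrow> Y \<in> C_Z \<Omega> Z \<Longrightarrow> (\<And>x. x \<in> \<Omega> \<Longrightarrow> W x \<le> Y x) \<Longrightarrow> upper W \<le> \<psi> Y"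
  unfolding upper_def by (intro cINF_lower bdd_below_majorants) (auto simp: majorants_def)

lemma upper_ge: "Z_bounded \<Omega> Z W \<Longrightarrow>
    (\<And>Y. Y \<in> C_Z \<Omega> Z \<Longrightarrow> (\<And>x. x \<in> \<Omega> \<Longrightarrow> W x \<le> Y x) \<Longrightarrow> b \<le> \<psi> Y) \<Longrightarrow> b \<le> upper W"
  unfolding upper_def by (intro cINF_greatest majorants_nonempty) (auto simp: majorants_def)

lemma upper_approx:
  assumes "Z_bounded \<Omega> Z W" "0 < e"
  obtains Y where "Y \<in> C_Z \<Omega> Z" "\<And>x. x \<in> \<Omega> \<Longrightarrow> W x \<le> Y x" "\<psi> Y < upper W + e"
proof -
  have "(INF Y\<in>majorants W. \<psi> Y) < upper W + e"
    using assms by (simp add: upper_def)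
  then show thesis
    using that assms by (subst (asm) cINF_less_iff[OF majorants_nonempty bdd_below_majorants])
      (auto simp: majorants_def)
qed

lemma upper_mono:
  "Z_bounded \<Omega> Z V \<Longrightarrow> Z_bounded \<Omega> Z W \<Longrightarrow> (\<And>x. x \<in> \<Omega> \<Longrightarrow> V x \<le> W x) \<Longrightarrow> upper V \<le> upper W"
  by (rule upper_ge) (auto intro!: upper_le intro: order_trans)

lemma \<psi>_le_upper: "X \<in> U_Z \<Omega> Z \<Longrightarrow> \<psi> X \<le> upper X"
  using C_Z_subset_U_Z by (intro upper_ge U_Z_D \<psi>_mono) auto

lemma upper_C_Z: "Y \<in> C_Z \<Omega> Z \<Longrightarrow> upper Y = \<psi> Y"
  using C_Z_subset_U_Z by (intro antisym upper_le \<psi>_le_upper C_Z_D) auto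

lemma convex_on_upper: "convex_on {W. Z_bounded \<Omega> Z W} upper"
proof (rule convex_onI)
  show "convex {W. Z_bounded \<Omega> Z W}"
    by (rule subspace_imp_convex[OF subspace_Z_bounded])
  fix t :: real and V W
  assume t: "0 < t" "t < 1" and "V \<in> {W. Z_bounded \<Omega> Z W}" "W \<in> {W. Z_bounded \<Omega> Z W}"
  then have V: "Z_bounded \<Omega> Z V" and W: "Z_bounded \<Omega> Z W" by auto
  show "upper ((1 - t) *\<^sub>R V + t *\<^sub>R W) \<le> (1 - t) * upper V + t * upper W"
  proof (rule field_le_epsilon)
    fix e :: real assume e: "0 < e"
    obtain Y1 where Y1: "Y1 \<in> C_Z \<Omega> Z" "\<And>x. x \<in> \<Omega> \<Longrightarrow> V x \<le> Y1 x" "\<psi> Y1 < upper V + e"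
      using upper_approx[OF V e] by blast
    obtain Y2 where Y2: "Y2 \<in> C_Z \<Omega> Z" "\<And>x. x \<in> \<Omega> \<Longrightarrow> W x \<le> Y2 x" "\<psi> Y2 < upper W + e"
      using upper_approx[OF W e] by blast
    have "upper ((1 - t) *\<^sub>R V + t *\<^sub>R W) \<le> \<psi> (\<lambda>x. (1 - t) * Y1 x + (1 - (1 - t)) * Y2 x)"
      using t Y1 Y2 V W
      by (intro upper_le C_Z_combination Z_bounded_add Z_bounded_scaleR)
         (auto simp: scaleR_fun_def intro!: add_mono mult_left_mono)
    also have "\<dots> \<le> (1 - t) * \<psi> Y1 + (1 - (1 - t)) * \<psi> Y2"
      using convex[unfolded convex_functional_on_def, rule_format, of Y1 Y2 "1 - t"]
        Y1(1) Y2(1) t C_Z_subset_U_Z by auto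
    also have "\<dots> \<le> (1 - t) * (upper V + e) + t * (upper W + e)"
      using t Y1(3) Y2(3) by (auto intro!: add_mono mult_left_mono)
    also have "\<dots> = (1 - t) * upper V + t * upper W + e"
      by (simp add: algebra_simps)
    finally show "upper ((1 - t) *\<^sub>R V + t *\<^sub>R W) \<le> (1 - t) * upper V + t * upper W + e" .
  qed
qed

lemma upper_convexD:
  assumes "Z_bounded \<Omega> Z V" "Z_bounded \<Omega> Z W" "0 \<le> t" "t \<le> 1"
  shows "upper ((1 - t) *\<^sub>R V + t *\<^sub>R W) \<le> (1 - t) * upper V + t * upper W"
  using convex_onD[OF convex_on_upper, of t V W] assms by simp

text \<open>If \<open>upper\<close> is at most B at X + W/t, convexity gives at most (1 - t) upper X
  + t B at X + W. The bound B found here for all late \<open>W n\<close> does not depend on t, so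
  there is no circularity: B is fixed first, then t, and after it N, z and m in turn.\<close>

lemma upper_continuous_above:
  assumes X: "Z_bounded \<Omega> Z X"
    and cont: "\<And>n::nat. continuous_on \<Omega> (W n)" and bnd: "\<And>n. Z_bounded \<Omega> Z (W n)"
    and dec: "\<And>x. x \<in> \<Omega> \<Longrightarrow> decseq (\<lambda>n. W n x)"
    and lim0: "\<And>x. x \<in> \<Omega> \<Longrightarrow> (\<lambda>n. W n x) \<longlonglongrightarrow> 0"
  shows "(\<lambda>n. upper (X + W n)) \<longlonglongrightarrow> upper X"
proof (rule decreasing_tendsto)
  have W_nonneg: "0 \<le> W n x" if "x \<in> \<Omega>" for n x
    using dec[OF that] lim0[OF that] by (rule decseq_ge)
  show "\<forall>\<^sub>F n in sequentially. upper X \<le> upper (X + W n)"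
    using W_nonneg by (intro always_eventually allI upper_mono Z_bounded_add X bnd) auto
  fix b assume b: "upper X < b"
  obtain c where c: "0 \<le> c" "\<And>x. x \<in> \<Omega> \<Longrightarrow> \<bar>W 0 x\<bar> \<le> c * Z x"
    using bnd[of 0] by (rule Z_boundedE) blast
  let ?V = "2 *\<^sub>R (X + Z)"
  have V: "Z_bounded \<Omega> Z ?V"
    by (intro Z_bounded_scaleR Z_bounded_add X Z_bounded_Z)
  \<comment> \<open>For late n, X + (1/t) W n is at most half of 2 (X + Z) plus half of N (Z - z)^+,
    and the \<psi>-value of the latter function falls below \<psi> 0 + 1 once z is large.\<close>
  define B where "B = (1/2) * upper ?V + (1/2) * (\<psi> (\<lambda>_. 0) + 1)"
  define t where "t = min 1 ((b - upper X) / (\<bar>B - upper X\<bar> + 1))"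
  have t: "0 < t" "t \<le> 1" using b by (auto simp: t_def)
  have "t * (B - upper X) \<le> t * \<bar>B - upper X\<bar>"
    using t by (intro mult_left_mono) auto
  also have "\<dots> < t * (\<bar>B - upper X\<bar> + 1)" using t by simp
  also have "\<dots> \<le> (b - upper X) / (\<bar>B - upper X\<bar> + 1) * (\<bar>B - upper X\<bar> + 1)"
    by (intro mult_right_mono) (auto simp: t_def)
  also have "\<dots> = b - upper X" by simp
  finally have tb: "t * (B - upper X) < b - upper X" .
  \<comment> \<open>The coefficient 2 c of the weighted Dini estimate is divided by t, for W/t, and
    doubled, for the weight 1/2 in the convex combination.\<close>
  obtain N :: nat where N: "4 * c / t \<le> real N" using real_arch_simple by blast
  have "\<forall>\<^sub>F z in at_top. \<psi> (\<lambda>w. real N * pospart_shift \<Omega> Z z w) < \<psi> (\<lambda>_. 0) + 1"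
    by (rule order_tendstoD[OF lim]) simp
  moreover have "\<forall>\<^sub>F z::real in at_top. 0 \<le> z" by (rule eventually_ge_at_top)
  ultimately obtain z where z: "0 \<le> z" "\<psi> (\<lambda>w. real N * pospart_shift \<Omega> Z z w) < \<psi> (\<lambda>_. 0) + 1"
    using eventually_happens[OF eventually_conj] by (metis (mono_tags, lifting) trivial_limit_at_top_linorder)
  let ?P = "\<lambda>w. real N * pospart_shift \<Omega> Z z w"
  have P: "?P \<in> C_Z \<Omega> Z"
    using C_Z_combination[OF pospart_shift_C_Z pospart_shift_C_Z, of z z "real N" 0] z(1) by simp
  obtain m where m: "\<And>x. x \<in> \<Omega> \<Longrightarrow> W m x \<le> t * Z x + 2 * c * pospart_shift \<Omega> Z z x"
    using Dini_weighted[OF cont dec lim0 _ c(1) z(1) t(1)] c(2) by (meson abs_le_D1)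
  have "upper (X + W n) < b" if n: "m \<le> n" for n
  proof -
    have le: "(X + (1/t) *\<^sub>R W n) x \<le> ((1 - 1/2) *\<^sub>R ?V + (1/2) *\<^sub>R ?P) x" if x: "x \<in> \<Omega>" for x
    proof -
      have p: "0 \<le> pospart_shift \<Omega> Z z x" by (simp add: pospart_shift_def)
      have "W n x \<le> W m x"
        using dec[OF x] n by (simp add: decseq_def)
      also have "\<dots> \<le> t * Z x + 2 * c * pospart_shift \<Omega> Z z x" by (rule m[OF x])
      finally have "(1/t) * W n x \<le> Z x + (1/2) * ((4 * c / t) * pospart_shift \<Omega> Z z x)"
        using t by (simp add: field_simps)
      also have "\<dots> \<le> Z x + (1/2) * (real N * pospart_shift \<Omega> Z z x)"
        using mult_right_mono[OF N p] by simp
      finally show ?thesis by (simp add: scaleR_fun_def add_divide_distrib)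
    qed
    have "upper (X + (1/t) *\<^sub>R W n) \<le> upper ((1 - 1/2) *\<^sub>R ?V + (1/2) *\<^sub>R ?P)"
      using Z_bounded_add[OF X Z_bounded_scaleR[OF bnd]]
        Z_bounded_add[OF Z_bounded_scaleR[OF V] Z_bounded_scaleR[OF C_Z_D(2)[OF P]]] le
      by (rule upper_mono)
    also have "\<dots> \<le> (1 - 1/2) * upper ?V + (1/2) * upper ?P"
      by (rule upper_convexD[OF V C_Z_D(2)[OF P]]) auto
    also have "\<dots> \<le> B"
      using z(2) by (simp add: B_def upper_C_Z[OF P])
    finally have le_B: "upper (X + (1/t) *\<^sub>R W n) \<le> B" .
    have "X + W n = (1 - t) *\<^sub>R X + t *\<^sub>R (X + (1/t) *\<^sub>R W n)"
      using t by (simp add: scaleR_add_right scaleR_left_diff_distrib)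
    then have "upper (X + W n) = upper ((1 - t) *\<^sub>R X + t *\<^sub>R (X + (1/t) *\<^sub>R W n))"
      by (rule arg_cong)
    also have "\<dots> \<le> (1 - t) * upper X + t * upper (X + (1/t) *\<^sub>R W n)"
      using t by (intro upper_convexD Z_bounded_add Z_bounded_scaleR X bnd) auto
    also have "\<dots> \<le> (1 - t) * upper X + t * B"
      using mult_left_mono[OF le_B, of t] t by linarith
    also have "\<dots> < b" using tb unfolding left_diff_distrib right_diff_distrib by linarith
    finally show ?thesis .
  qed
  then show "\<forall>\<^sub>F n in sequentially. upper (X + W n) < b"
    by (auto simp: eventually_sequentially)
qed

text \<open>A subgradient inequality for \<open>upper\<close> at \<open>X\<close>, tested only on
  \<open>C_Z\<close>, which is all that the conjugate over \<open>C_Z\<close> sees.\<close>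

lemma upper_subgradient_representation:
  assumes X: "X \<in> U_Z \<Omega> Z"
  obtains M where "M \<in> ca_Z \<Omega> Z"
    "\<And>Y. Y \<in> C_Z \<Omega> Z \<Longrightarrow> upper X + pairing Y M - pairing X M \<le> \<psi> Y"
proof -
  let ?B = "{W. Z_bounded \<Omega> Z W}"
  have XB: "Z_bounded \<Omega> Z X" using X by (rule U_Z_D)
  obtain l where l_add: "\<And>V W. V \<in> ?B \<Longrightarrow> W \<in> ?B \<Longrightarrow> l (V + W) = l V + l W"
    and l_scale: "\<And>W c. W \<in> ?B \<Longrightarrow> l (c *\<^sub>R W) = c * l W"
    and l_sub: "\<And>W. W \<in> ?B \<Longrightarrow> l (W - X) \<le> upper W - upper X"
    by (rule convex_on_subgradient[OF convex_on_upper subspace_Z_bounded CollectI[where P = "Z_bounded \<Omega> Z", OF XB]])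
       (rule that)
  have l_le: "l W \<le> upper (X + W) - upper X" if "W \<in> ?B" for W
    using l_sub[of "X + W"] XB that by (simp add: Z_bounded_add)
  have l_diff: "l (V - W) = l V - l W" if "V \<in> ?B" "W \<in> ?B" for V W
    using l_add[of "V - W" W] that by (simp add: Z_bounded_diff)
  have l_mono: "l V \<le> l W" if "V \<in> ?B" "W \<in> ?B" "\<And>x. x \<in> \<Omega> \<Longrightarrow> V x \<le> W x" for V W
  proof -
    \<comment> \<open>Subgradients of an increasing function are increasing: V - W is a nonpositive
      direction on \<Omega>.\<close>
    have "upper (X + (V - W)) \<le> upper X"
      using that XB by (intro upper_mono Z_bounded_add Z_bounded_diff) auto
    then show ?thesis
      using l_le[of "V - W"] l_diff[of V W] that by (simp add: Z_bounded_diff)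
  qed
  define L where "L g = l (\<lambda>x. g x * Z x)" for g
  have gZ: "Z_bounded \<Omega> Z (\<lambda>x. g x * Z x)" if g: "g \<in> bounded_continuous \<Omega>" for g
  proof -
    obtain c where "\<And>x. x \<in> \<Omega> \<Longrightarrow> \<bar>g x\<bar> \<le> c"
      using g by (auto simp: bounded_continuous_iff)
    then show ?thesis
      using Z_pos by (intro Z_boundedI[of _ c]) (simp add: abs_mult abs_of_pos)
  qed
  interpret L: Daniell_functional \<Omega> L
  proof
    fix f g assume fg: "f \<in> bounded_continuous \<Omega>" "g \<in> bounded_continuous \<Omega>"
    show "L (\<lambda>x. f x + g x) = L f + L g"
      using l_add[of "\<lambda>x. f x * Z x" "\<lambda>x. g x * Z x"] fg
      by (simp add: L_def gZ plus_fun_def distrib_right)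
    show "L f \<le> L g" if "\<And>x. x \<in> \<Omega> \<Longrightarrow> f x \<le> g x"
      unfolding L_def using fg that Z_pos
      by (intro l_mono) (auto simp: gZ intro!: mult_right_mono less_imp_le)
    show "L (\<lambda>x. c * f x) = c * L f" for c
      using l_scale[of "\<lambda>x. f x * Z x" c] fg
      by (simp add: L_def gZ scaleR_fun_def mult.assoc)
  next
    fix f :: "nat \<Rightarrow> 'a \<Rightarrow> real"
    assume f: "\<And>n. f n \<in> bounded_continuous \<Omega>"
      and dec: "\<And>x. x \<in> \<Omega> \<Longrightarrow> decseq (\<lambda>n. f n x)"
      and lim0: "\<And>x. x \<in> \<Omega> \<Longrightarrow> (\<lambda>n. f n x) \<longlonglongrightarrow> 0"
    let ?W = "\<lambda>n x. f n x * Z x"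
    have dec': "decseq (\<lambda>n. ?W n x)" if "x \<in> \<Omega>" for x
      using dec[OF that] Z_pos[OF that] by (auto simp: decseq_def intro!: mult_right_mono less_imp_le)
    have lim': "(\<lambda>n. ?W n x) \<longlonglongrightarrow> 0" if "x \<in> \<Omega>" for x
      using tendsto_mult_right[OF lim0[OF that], of "Z x"] by simp
    have "(\<lambda>n. upper (X + ?W n)) \<longlonglongrightarrow> upper X"
    proof (rule upper_continuous_above[OF XB])
      show "continuous_on \<Omega> (?W n)" for n
        using f by (intro continuous_on_mult Z_cont) (simp add: bounded_continuous_def)
    qed (use f gZ dec' lim' in auto)
    then have "(\<lambda>n. upper (X + ?W n) - upper X) \<longlonglongrightarrow> upper X - upper X"
      by (intro tendsto_diff tendsto_const)
    then have up: "(\<lambda>n. upper (X + ?W n) - upper X) \<longlonglongrightarrow> 0" by simp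
    \<comment> \<open>Positivity of \<open>l\<close> bounds from below, the subgradient inequality
      at X + ?W n from above.\<close>
    show "(\<lambda>n. L (f n)) \<longlonglongrightarrow> 0"
    proof (rule tendsto_sandwich[OF _ _ tendsto_const up])
      have "l (\<lambda>x. 0 * Z x) \<le> l (?W n)" for n
        using decseq_ge[OF dec' lim'] f gZ by (intro l_mono) (auto intro: Z_boundedI[of _ 0])
      moreover have "l (\<lambda>x. 0 * Z x) = 0"
        using l_scale[of Z 0] by (simp add: Z_bounded_Z scaleR_fun_def)
      ultimately show "\<forall>\<^sub>F n in sequentially. 0 \<le> L (f n)"
        by (simp add: L_def)
      show "\<forall>\<^sub>F n in sequentially. L (f n) \<le> upper (X + ?W n) - upper X"
        unfolding L_def using f gZ by (intro always_eventually allI l_le) auto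
    qed
  qed
  obtain N where sets_N: "sets N = sets (restrict_space borel \<Omega>)" and "finite_measure N"
    and int_N: "\<And>f. f \<in> bounded_continuous \<Omega> \<Longrightarrow> (\<integral>x. f x \<partial>N) = L f"
    by (rule L.representation) (rule that)
  interpret N: finite_measure N by fact
  have space_N: "space N = \<Omega>"
    using sets_eq_imp_space_eq[OF sets_N] by (simp add: space_restrict_space)
  have meas_N: "f \<in> borel_measurable N" if "f \<in> borel_measurable (restrict_space borel \<Omega>)" for f :: "'a \<Rightarrow> real"
    using that by (simp add: sets_N cong: measurable_cong_sets)
  have Z_meas: "Z \<in> borel_measurable N"
    by (rule meas_N[OF borel_measurable_continuous_on_restrict[OF Z_cont]])
  \<comment> \<open>This undoes the factor \<open>Z\<close> in \<open>L\<close>, and the integral of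
    \<open>Z\<close> becomes the total mass of \<open>N\<close>, which is finite.\<close>
  define M where "M = density N (\<lambda>x. ennreal (1 / Z x))"
  have "(\<integral>\<^sup>+x. ennreal (Z x) \<partial>M) = (\<integral>\<^sup>+x. ennreal (1 / Z x) * ennreal (Z x) \<partial>N)"
    unfolding M_def using Z_meas by (intro nn_integral_density) auto
  also have "\<dots> = (\<integral>\<^sup>+x. 1 \<partial>N)"
  proof (rule nn_integral_cong)
    fix x assume "x \<in> space N"
    then have "0 < Z x" using Z_pos by (simp add: space_N)
    then show "ennreal (1 / Z x) * ennreal (Z x) = 1"
      by (simp flip: ennreal_mult)
  qed
  also have "\<dots> < \<infinity>"
    using N.emeasure_finite[of "space N"] by (simp add: less_top[symmetric])
  finally have M: "M \<in> ca_Z \<Omega> Z"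
    by (simp add: ca_Z_def M_def sets_N)
  have l_C: "l Y = pairing Y M" if Y: "Y \<in> C_Z \<Omega> Z" for Y
  proof -
    obtain c where c: "\<And>x. x \<in> \<Omega> \<Longrightarrow> \<bar>Y x\<bar> \<le> c * Z x"
      using C_Z_D(2)[OF Y] by (rule Z_boundedE) blast
    have bc: "(\<lambda>x. (1 / Z x) * Y x) \<in> bounded_continuous \<Omega>"
      unfolding bounded_continuous_iff
    proof
      show "continuous_on \<Omega> (\<lambda>x. (1 / Z x) * Y x)"
        using C_Z_D(1)[OF Y] Z_cont Z_pos by (intro continuous_intros) (auto simp: less_imp_neq[symmetric])
      have "\<bar>(1 / Z x) * Y x\<bar> \<le> c" if "x \<in> \<Omega>" for x
        using c[OF that] Z_pos[OF that] by (simp add: field_simps)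
      then show "\<exists>B. \<forall>x\<in>\<Omega>. \<bar>(1 / Z x) * Y x\<bar> \<le> B" by blast
    qed
    have "pairing Y M = (\<integral>x. (1 / Z x) * Y x \<partial>N)"
      unfolding pairing_def M_def
    proof (subst integral_density)
      show "Y \<in> borel_measurable N"
        by (rule meas_N[OF borel_measurable_continuous_on_restrict[OF C_Z_D(1)[OF Y]]])
      show "AE x in N. 0 \<le> 1 / Z x"
        using Z_pos by (intro AE_I2) (simp add: space_N less_imp_le)
    qed (use Z_meas in auto)
    also have "\<dots> = l (\<lambda>x. (1 / Z x) * Y x * Z x)"
      by (simp only: int_N[OF bc] L_def)
    also have "\<dots> = l Y"
    proof (rule antisym)
      have "(1 / Z x) * Y x * Z x = Y x" if "x \<in> \<Omega>" for x
        using Z_pos[OF that] by simp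
      then show "l (\<lambda>x. (1 / Z x) * Y x * Z x) \<le> l Y" "l Y \<le> l (\<lambda>x. (1 / Z x) * Y x * Z x)"
        using gZ[OF bc] C_Z_D(2)[OF Y] by (auto intro!: l_mono)
    qed
    finally show ?thesis ..
  qed
  obtain Xs and c :: real where Xs: "\<And>n::nat. Xs n \<in> C_Z \<Omega> Z"
    "\<And>x. x \<in> \<Omega> \<Longrightarrow> decseq (\<lambda>n. Xs n x)" "\<And>x. x \<in> \<Omega> \<Longrightarrow> (\<lambda>n. Xs n x) \<longlonglongrightarrow> X x"
    "\<And>n x. x \<in> \<Omega> \<Longrightarrow> \<bar>Xs n x\<bar> \<le> c * Z x"
    by (rule U_Z_approx[OF X]) (rule that)
  have "(\<lambda>n. pairing (Xs n) M) \<longlonglongrightarrow> pairing X M"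
    unfolding pairing_def
  proof (rule integral_dominated_convergence)
    show "integrable M (\<lambda>x. c * Z x)"
      by (intro integrable_mult_right ca_Z_integrable_Z M)
    show "X \<in> borel_measurable M"
      using ca_Z_integrable[OF M X] by simp
    show "Xs n \<in> borel_measurable M" for n
      using ca_Z_integrable[OF M] Xs(1) C_Z_subset_U_Z by blast
    show "AE x in M. (\<lambda>n. Xs n x) \<longlonglongrightarrow> X x"
      using Xs(3) by (intro AE_I2) (simp add: ca_Z_space[OF M])
    show "AE x in M. norm (Xs n x) \<le> c * Z x" for n
      using Xs(4) by (intro AE_I2) (simp add: ca_Z_space[OF M])
  qed
  \<comment> \<open>\<open>X\<close> need not lie in \<open>C_Z\<close>, so monotonicity only bounds
    l X from above. This direction suffices, because l X enters the subgradient inequality with a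
    minus sign.\<close>
  moreover have "l X \<le> pairing (Xs n) M" for n
    unfolding l_C[OF Xs(1), symmetric]
    using decseq_ge[OF Xs(2,3)] XB C_Z_D(2)[OF Xs(1)] by (intro l_mono) auto
  ultimately have l_X: "l X \<le> pairing X M"
    by (intro LIMSEQ_le_const) auto
  show thesis
  proof (rule that[OF M])
    fix Y assume Y: "Y \<in> C_Z \<Omega> Z"
    have "l Y - l X \<le> \<psi> Y - upper X"
      using l_sub[of Y] l_diff[of Y X] XB C_Z_D(2)[OF Y] by (simp add: upper_C_Z[OF Y])
    with l_X l_C[OF Y] show "upper X + pairing Y M - pairing X M \<le> \<psi> Y" by simp
  qed
qed

section \<open>Conjugates and the four equivalences\<close>

lemma zero_C_Z: "(\<lambda>_. 0) \<in> C_Z \<Omega> Z"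
  by (auto simp: C_Z_def intro: Z_boundedI[of _ 0])

lemma pairing_le_conj: "Y \<in> S \<Longrightarrow> ereal (pairing Y M - \<psi> Y) \<le> conj S \<psi> M"
  unfolding conj_def by (rule SUP_upper)

lemma le_pairing_minus_conjI:
  assumes "\<And>Y. Y \<in> C_Z \<Omega> Z \<Longrightarrow> a + pairing Y M - b \<le> \<psi> Y"
  shows "ereal a \<le> ereal b - conj (C_Z \<Omega> Z) \<psi> M"
proof -
  have le: "conj (C_Z \<Omega> Z) \<psi> M \<le> ereal (b - a)"
    unfolding conj_def
  proof (rule SUP_least)
    fix Y assume "Y \<in> C_Z \<Omega> Z"
    from assms[OF this] show "ereal (pairing Y M - \<psi> Y) \<le> ereal (b - a)" by simp
  qed
  then show ?thesis
    by (cases "conj (C_Z \<Omega> Z) \<psi> M") auto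
qed

text \<open>The Fenchel-Young inequality, rearranged. The conjugate may be \<infinity>, which makes
  the left side -\<infinity>, but it is never -\<infinity> itself, since it dominates the real term
  of \<open>Y\<close>.\<close>

lemma pairing_minus_conj_le:
  assumes "Y \<in> S"
  shows "ereal (pairing Y M) - conj S \<psi> M \<le> ereal (\<psi> Y)"
  using pairing_le_conj[OF assms, of M] by (cases "conj S \<psi> M") auto

text \<open>Together with \<open>pairing_minus_conj_le_upper\<close> this makes
  \<open>upper X\<close> the maximum in the dual formula, whether or not it equals
  \<open>\<psi> X\<close>. The maximum is attained because a subgradient is an actual
  measure.\<close>

lemma upper_le_pairing_minus_conj:
  assumes "X \<in> U_Z \<Omega> Z"
  obtains M where "M \<in> ca_Z \<Omega> Z" "ereal (upper X) \<le> ereal (pairing X M) - conj (C_Z \<Omega> Z) \<psi> M"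
proof (rule upper_subgradient_representation[OF assms])
  fix M assume "M \<in> ca_Z \<Omega> Z" "\<And>Y. Y \<in> C_Z \<Omega> Z \<Longrightarrow> upper X + pairing Y M - pairing X M \<le> \<psi> Y"
  then show thesis by (intro that le_pairing_minus_conjI)
qed

lemma ereal_upper:
  assumes "Z_bounded \<Omega> Z W"
  shows "ereal (upper W) = (INF Y\<in>majorants W. ereal (\<psi> Y))"
  unfolding upper_def
  using ereal_Inf'[OF bdd_below_majorants[OF assms]] majorants_nonempty[OF assms]
  by (simp add: image_comp)

text \<open>Fenchel-Young over \<open>C_Z\<close> does not apply to \<open>X\<close> itself, but it
  applies to each continuous majorant, whose integral is at least that of \<open>X\<close>.\<close>

lemma pairing_minus_conj_le_upper:
  assumes M: "M \<in> ca_Z \<Omega> Z" and X: "X \<in> U_Z \<Omega> Z"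
  shows "ereal (pairing X M) - conj (C_Z \<Omega> Z) \<psi> M \<le> ereal (upper X)"
proof -
  have "ereal (pairing X M) - conj (C_Z \<Omega> Z) \<psi> M \<le> ereal (\<psi> Y)"
    if Y: "Y \<in> C_Z \<Omega> Z" "\<And>x. x \<in> \<Omega> \<Longrightarrow> X x \<le> Y x" for Y
  proof -
    have "pairing X M \<le> pairing Y M"
      using M X Y C_Z_subset_U_Z by (intro pairing_mono) auto
    then have "ereal (pairing X M) - conj (C_Z \<Omega> Z) \<psi> M \<le> ereal (pairing Y M) - conj (C_Z \<Omega> Z) \<psi> M"
      by (intro ereal_minus_mono) auto
    also have "\<dots> \<le> ereal (\<psi> Y)"
      by (rule pairing_minus_conj_le[OF Y(1)])
    finally show ?thesis .
  qed
  then have "ereal (pairing X M) - conj (C_Z \<Omega> Z) \<psi> M \<le> (INF Y\<in>majorants X. ereal (\<psi> Y))"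
    by (intro INF_greatest) (auto simp: majorants_def)
  also have "\<dots> = ereal (upper X)"
    by (rule ereal_upper[OF U_Z_D(2)[OF X], symmetric])
  finally show ?thesis .
qed

lemma inf_iff_upper:
  assumes "X \<in> U_Z \<Omega> Z"
  shows "ereal (\<psi> X) = (INF Y\<in>{Y\<in>C_Z \<Omega> Z. \<forall>w\<in>\<Omega>. X w \<le> Y w}. ereal (\<psi> Y)) \<longleftrightarrow> \<psi> X = upper X"
  using ereal_upper[OF U_Z_D(2)[OF assms]] unfolding majorants_def by (metis ereal.inject)

lemma max_iff_upper:
  "(\<forall>X\<in>U_Z \<Omega> Z.
      (\<exists>M\<in>ca_Z \<Omega> Z. ereal (\<psi> X) = ereal (pairing X M) - conj (C_Z \<Omega> Z) \<psi> M) \<and>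
      (\<forall>M\<in>ca_Z \<Omega> Z. ereal (pairing X M) - conj (C_Z \<Omega> Z) \<psi> M \<le> ereal (\<psi> X)))
   \<longleftrightarrow> (\<forall>X\<in>U_Z \<Omega> Z. \<psi> X = upper X)" (is "?max \<longleftrightarrow> ?upper")
proof
  assume max: ?max
  show ?upper
  proof
    fix X assume X: "X \<in> U_Z \<Omega> Z"
    obtain M where M: "M \<in> ca_Z \<Omega> Z" "ereal (upper X) \<le> ereal (pairing X M) - conj (C_Z \<Omega> Z) \<psi> M"
      using X by (rule upper_le_pairing_minus_conj)
    have "ereal (upper X) \<le> ereal (\<psi> X)"
      using max X M(1) order_trans[OF M(2)] by blast
    with \<psi>_le_upper[OF X] show "\<psi> X = upper X" by simp
  qed
next
  assume upper: ?upper
  show ?max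
  proof
    fix X assume X: "X \<in> U_Z \<Omega> Z"
    obtain M where M: "M \<in> ca_Z \<Omega> Z" "ereal (upper X) \<le> ereal (pairing X M) - conj (C_Z \<Omega> Z) \<psi> M"
      using X by (rule upper_le_pairing_minus_conj)
    have "\<psi> X = upper X" using upper X by blast
    then show "(\<exists>M\<in>ca_Z \<Omega> Z. ereal (\<psi> X) = ereal (pairing X M) - conj (C_Z \<Omega> Z) \<psi> M) \<and>
      (\<forall>M\<in>ca_Z \<Omega> Z. ereal (pairing X M) - conj (C_Z \<Omega> Z) \<psi> M \<le> ereal (\<psi> X))"
      using M pairing_minus_conj_le_upper[OF _ X] by (auto intro!: antisym bexI[OF _ M(1)])
  qed
qed

text \<open>If the conjugates agree, Fenchel-Young over \<open>U_Z\<close> applies to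
  \<open>X\<close> itself and the measure representing a subgradient gives upper X \<le> \<psi> X.
  Conversely, the bound by \<open>upper\<close> turns into Fenchel-Young for all of
  \<open>U_Z\<close> with the conjugate over \<open>C_Z\<close>.\<close>

lemma conj_iff_upper:
  "(\<forall>M\<in>ca_Z \<Omega> Z. conj (C_Z \<Omega> Z) \<psi> M = conj (U_Z \<Omega> Z) \<psi> M) \<longleftrightarrow> (\<forall>X\<in>U_Z \<Omega> Z. \<psi> X = upper X)"
  (is "?conj \<longleftrightarrow> ?upper")
proof
  assume conj: ?conj
  show ?upper
  proof
    fix X assume X: "X \<in> U_Z \<Omega> Z"
    obtain M where M: "M \<in> ca_Z \<Omega> Z" "ereal (upper X) \<le> ereal (pairing X M) - conj (C_Z \<Omega> Z) \<psi> M"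
      using X by (rule upper_le_pairing_minus_conj)
    have "conj (C_Z \<Omega> Z) \<psi> M = conj (U_Z \<Omega> Z) \<psi> M"
      using conj M(1) by blast
    then have "ereal (upper X) \<le> ereal (pairing X M) - conj (U_Z \<Omega> Z) \<psi> M"
      using M(2) by simp
    also have "\<dots> \<le> ereal (\<psi> X)"
      by (rule pairing_minus_conj_le[OF X])
    finally have "upper X \<le> \<psi> X" by simp
    with \<psi>_le_upper[OF X] show "\<psi> X = upper X" by simp
  qed
next
  assume upper: ?upper
  show ?conj
  proof
    fix M assume M: "M \<in> ca_Z \<Omega> Z"
    show "conj (C_Z \<Omega> Z) \<psi> M = conj (U_Z \<Omega> Z) \<psi> M"
    proof (rule antisym)
      show "conj (C_Z \<Omega> Z) \<psi> M \<le> conj (U_Z \<Omega> Z) \<psi> M"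
        unfolding conj_def using C_Z_subset_U_Z by (intro SUP_subset_mono) auto
      show "conj (U_Z \<Omega> Z) \<psi> M \<le> conj (C_Z \<Omega> Z) \<psi> M"
        unfolding conj_def[of "U_Z \<Omega> Z"]
      proof (rule SUP_least)
        fix X assume X: "X \<in> U_Z \<Omega> Z"
        have "ereal (pairing X M) - conj (C_Z \<Omega> Z) \<psi> M \<le> ereal (\<psi> X)"
          using pairing_minus_conj_le_upper[OF M X] upper X by simp
        moreover have "conj (C_Z \<Omega> Z) \<psi> M \<noteq> -\<infinity>"
          using pairing_le_conj[OF zero_C_Z, of M] by auto
        ultimately show "ereal (pairing X M - \<psi> X) \<le> conj (C_Z \<Omega> Z) \<psi> M"
          by (cases "conj (C_Z \<Omega> Z) \<psi> M") auto
      qed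
    qed
  qed
qed

lemma seq_iff_upper:
  "(\<forall>X\<in>U_Z \<Omega> Z. \<forall>Xs :: nat \<Rightarrow> 'a \<Rightarrow> real.
      (\<forall>n. Xs n \<in> C_Z \<Omega> Z) \<and> (\<forall>w\<in>\<Omega>. decseq (\<lambda>n. Xs n w) \<and> (\<lambda>n. Xs n w) \<longlonglongrightarrow> X w)
      \<longrightarrow> decseq (\<lambda>n. \<psi> (Xs n)) \<and> (\<lambda>n. \<psi> (Xs n)) \<longlonglongrightarrow> \<psi> X)
   \<longleftrightarrow> (\<forall>X\<in>U_Z \<Omega> Z. \<psi> X = upper X)" (is "?seq \<longleftrightarrow> ?upper")
proof
  assume seq: ?seq
  show ?upper
  proof
    fix X assume X: "X \<in> U_Z \<Omega> Z"
    obtain Xs where Xs: "\<And>n::nat. Xs n \<in> C_Z \<Omega> Z"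
      "\<And>x. x \<in> \<Omega> \<Longrightarrow> decseq (\<lambda>n. Xs n x)" "\<And>x. x \<in> \<Omega> \<Longrightarrow> (\<lambda>n. Xs n x) \<longlonglongrightarrow> X x"
      by (rule U_Z_approx[OF X]) (rule that)
    have "(\<lambda>n. \<psi> (Xs n)) \<longlonglongrightarrow> \<psi> X"
      using seq[rule_format, OF X, of Xs] Xs by blast
    moreover have "upper X \<le> \<psi> (Xs n)" for n
      using decseq_ge[OF Xs(2,3)] by (intro upper_le U_Z_D[OF X] Xs)
    ultimately have "upper X \<le> \<psi> X"
      by (intro LIMSEQ_le_const) auto
    with \<psi>_le_upper[OF X] show "\<psi> X = upper X" by simp
  qed
next
  assume upper: ?upper
  show ?seq
  proof (intro ballI allI impI, elim conjE)
    fix X and Xs :: "nat \<Rightarrow> 'a \<Rightarrow> real"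
    assume X: "X \<in> U_Z \<Omega> Z" and XsC: "\<forall>n. Xs n \<in> C_Z \<Omega> Z"
      and "\<forall>w\<in>\<Omega>. decseq (\<lambda>n. Xs n w) \<and> (\<lambda>n. Xs n w) \<longlonglongrightarrow> X w"
    then have Xs: "\<And>n. Xs n \<in> C_Z \<Omega> Z" and dec: "\<And>x. x \<in> \<Omega> \<Longrightarrow> decseq (\<lambda>n. Xs n x)"
      and lim: "\<And>x. x \<in> \<Omega> \<Longrightarrow> (\<lambda>n. Xs n x) \<longlonglongrightarrow> X x"
      by auto
    have XsU: "Xs n \<in> U_Z \<Omega> Z" for n
      using Xs C_Z_subset_U_Z by blast
    have dec_\<psi>: "decseq (\<lambda>n. \<psi> (Xs n))"
      using dec by (intro decseq_SucI \<psi>_mono XsU) (auto simp: decseq_def)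
    have "(\<lambda>n. \<psi> (Xs n)) \<longlonglongrightarrow> \<psi> X"
    proof (rule decreasing_tendsto)
      show "\<forall>\<^sub>F n in sequentially. \<psi> X \<le> \<psi> (Xs n)"
        using decseq_ge[OF dec lim] by (intro always_eventually allI \<psi>_mono X XsU)
      fix b assume "\<psi> X < b"
      then have b: "0 < b - upper X" using upper X by simp
      obtain Y where Y: "Y \<in> C_Z \<Omega> Z" "\<And>x. x \<in> \<Omega> \<Longrightarrow> X x \<le> Y x" "\<psi> Y < upper X + (b - upper X)"
        using U_Z_D(2)[OF X] b by (rule upper_approx) blast
      \<comment> \<open>Xs n - X need not be continuous, so continuity from above is used at the
        near-optimal majorant \<open>Y\<close> instead: as X \<le> Y, the maxima of
        \<open>Xs n\<close> and \<open>Y\<close> decrease to \<open>Y\<close>, and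
        \<open>W n\<close> is continuous with limit 0.\<close>
      define W where "W n x = max (Xs n x) (Y x) - Y x" for n x
      have V: "(\<lambda>x. max (Xs n x) (Y x)) \<in> C_Z \<Omega> Z" for n
        by (intro C_Z_max Xs Y)
      have YW: "Y + W n = (\<lambda>x. max (Xs n x) (Y x))" for n
        by (simp add: W_def plus_fun_def)
      have WC: "W n \<in> C_Z \<Omega> Z" for n
        using C_Z_combination[OF V[of n] Y(1), of 1 "-1"] by (simp add: W_def[abs_def])
      have "(\<lambda>n. upper (Y + W n)) \<longlonglongrightarrow> upper Y"
      proof (rule upper_continuous_above)
        show "decseq (\<lambda>n. W n x)" if "x \<in> \<Omega>" for x
          using dec[OF that] by (auto simp: decseq_def W_def intro: max.coboundedI1)
        show "(\<lambda>n. W n x) \<longlonglongrightarrow> 0" if "x \<in> \<Omega>" for x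
        proof -
          have "(\<lambda>n. max (Xs n x) (Y x) - Y x) \<longlonglongrightarrow> max (X x) (Y x) - Y x"
            by (intro tendsto_diff tendsto_max tendsto_const lim that)
          then show ?thesis using Y(2)[OF that] by (simp add: W_def)
        qed
      qed (use C_Z_D Y(1) WC in auto)
      then have "\<forall>\<^sub>F n in sequentially. upper (Y + W n) < b"
        using Y(3) by (intro order_tendstoD(2)) (auto simp: upper_C_Z[OF Y(1)])
      then show "\<forall>\<^sub>F n in sequentially. \<psi> (Xs n) < b"
      proof eventually_elim
        case (elim n)
        have "\<psi> (Xs n) \<le> \<psi> (\<lambda>x. max (Xs n x) (Y x))"
          using C_Z_subset_U_Z V by (intro \<psi>_mono XsU) auto
        also have "\<dots> = upper (Y + W n)"
          unfolding YW by (rule upper_C_Z[OF V, symmetric])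
        finally show ?case using elim by simp
      qed
    qed
    with dec_\<psi> show "decseq (\<lambda>n. \<psi> (Xs n)) \<and> (\<lambda>n. \<psi> (Xs n)) \<longlonglongrightarrow> \<psi> X" ..
  qed
qed

end

text \<open>The index types \<open>'t\<close> and \<open>'i\<close> are finite and nonempty and
  stand for T and J + 1; \<open>i0\<close> marks the coordinate that is positive at each time. The
  equivalences are stated as a chain of three.\<close>

theorem theoremA5:
  fixes \<Omega> :: "(real ^ 'i ^ 't) set"
    and i0 :: 'i
    and Z :: "real ^ 'i ^ 't \<Rightarrow> real"
    and \<psi> :: "(real ^ 'i ^ 't \<Rightarrow> real) \<Rightarrow> real"
  assumes \<Omega>_ne: "\<Omega> \<noteq> {}"
    and \<Omega>_sub: "\<Omega> \<subseteq> {w. \<forall>t. w $ t $ i0 > 0}"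
    and Z_cont: "continuous_on \<Omega> Z"
    and Z_ge1: "\<forall>w\<in>\<Omega>. Z w \<ge> 1"
    and Z_compact: "\<forall>z\<ge>0. compact {w\<in>\<Omega>. Z w \<le> z}"
    and \<psi>_incr: "increasing_on (U_Z \<Omega> Z) \<Omega> \<psi>"
    and \<psi>_convex: "convex_functional_on (U_Z \<Omega> Z) \<psi>"
    and \<psi>_lim: "\<forall>n::nat. ((\<lambda>z::real. \<psi> (\<lambda>w. real n * pospart_shift \<Omega> Z z w)) \<longlongrightarrow> \<psi> (\<lambda>_. 0)) at_top"
  shows
    "((\<forall>X\<in>U_Z \<Omega> Z.
         (\<exists>M\<in>ca_Z \<Omega> Z. ereal (\<psi> X) = ereal (pairing X M) - conj (C_Z \<Omega> Z) \<psi> M) \<and>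
         (\<forall>M\<in>ca_Z \<Omega> Z. ereal (pairing X M) - conj (C_Z \<Omega> Z) \<psi> M \<le> ereal (\<psi> X)))
      \<longleftrightarrow>
      (\<forall>X\<in>U_Z \<Omega> Z. \<forall>Xs :: nat \<Rightarrow> real ^ 'i ^ 't \<Rightarrow> real.
         (\<forall>n. Xs n \<in> C_Z \<Omega> Z) \<and> (\<forall>w\<in>\<Omega>. decseq (\<lambda>n. Xs n w) \<and> (\<lambda>n. Xs n w) \<longlonglongrightarrow> X w)
         \<longrightarrow> decseq (\<lambda>n. \<psi> (Xs n)) \<and> (\<lambda>n. \<psi> (Xs n)) \<longlonglongrightarrow> \<psi> X))
     \<and>
     ((\<forall>X\<in>U_Z \<Omega> Z. \<forall>Xs :: nat \<Rightarrow> real ^ 'i ^ 't \<Rightarrow> real.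
         (\<forall>n. Xs n \<in> C_Z \<Omega> Z) \<and> (\<forall>w\<in>\<Omega>. decseq (\<lambda>n. Xs n w) \<and> (\<lambda>n. Xs n w) \<longlonglongrightarrow> X w)
         \<longrightarrow> decseq (\<lambda>n. \<psi> (Xs n)) \<and> (\<lambda>n. \<psi> (Xs n)) \<longlonglongrightarrow> \<psi> X)
      \<longleftrightarrow>
      (\<forall>X\<in>U_Z \<Omega> Z. ereal (\<psi> X) = (INF Y\<in>{Y\<in>C_Z \<Omega> Z. \<forall>w\<in>\<Omega>. X w \<le> Y w}. ereal (\<psi> Y))))
     \<and>
     ((\<forall>X\<in>U_Z \<Omega> Z. ereal (\<psi> X) = (INF Y\<in>{Y\<in>C_Z \<Omega> Z. \<forall>w\<in>\<Omega>. X w \<le> Y w}. ereal (\<psi> Y)))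
      \<longleftrightarrow>
      (\<forall>M\<in>ca_Z \<Omega> Z. conj (C_Z \<Omega> Z) \<psi> M = conj (U_Z \<Omega> Z) \<psi> M))"
proof -
  interpret increasing_convex_functional \<Omega> Z \<psi>
    using assms by unfold_locales auto
  have inf_iff: "(\<forall>X\<in>U_Z \<Omega> Z. ereal (\<psi> X) = (INF Y\<in>{Y\<in>C_Z \<Omega> Z. \<forall>w\<in>\<Omega>. X w \<le> Y w}. ereal (\<psi> Y)))
      \<longleftrightarrow> (\<forall>X\<in>U_Z \<Omega> Z. \<psi> X = upper X)"
    by (rule ball_cong[OF refl inf_iff_upper])
  show ?thesis
    unfolding max_iff_upper seq_iff_upper inf_iff conj_iff_upper by simp
qed

end
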